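(* Let $k\ge 3$. Let $G=(V,E)$ be a $(k-2)$-connected $k$-colorable chordal graph, and let $T\subseteq V$ be a clique of $G$ with $m=|T|\ge k-2$. Then the contracted solution graph $\mathcal{C}^c_k(G,T)$ is an $(m,k)$-color-complete graph, or it is a forest that satisfies the injective neighborhood property.
   Context: Graphs are finite and simple. A $k$-coloring of $G$ is a map $\alpha:V(G)\to\{1,\dots,k\}$ with $\alpha(u)\ne\alpha(v)$ for all edges $uv$. The $k$-color graph $\mathcal{C}_k(G)$ has the $k$-colorings of $G$ as nodes, two adjacent iff they differ on exactly one vertex. A chordal graph has no induced cycle of length $>3$; for $\ell\ge1$, $G$ is $\ell$-connected if $|V(G)|\ge \ell+1$ and every vertex cut has at least $\ell$ vertices. For $T\subseteq V(G)$, give each $k$-coloring $\gamma$ of $G$ the label $\gamma|_T$. A label component is a maximal set of $k$-colorings of $G$ that all have the same label and induce a connected subgraph of $\mathcal{C}_k(G)$. The contracted solution graph $\mathcal{C}^c_k(G,T)$ is the labeled graph $(H,\ell)$ whose nodes $x$ correspond bijectively to the label components $S_x$, where distinct $x,y$ are adjacent iff some $\gamma\in S_x$ and $\gamma'\in S_y$ are adjacent in $\mathcal{C}_k(G)$, and $\ell(x)$ is the common label of the colorings in $S_x$ (so $\ell(x)$ is a $k$-coloring of $G[T]$). Labeled graphs are identified up to label-preserving isomorphism. For $1\le m\le k$, a labeled graph $(H,\ell)$ is $(m,k)$-color-complete if there is a set $T$ with $|T|=m$ such that every label $\ell(v)$ is a $k$-coloring of the complete graph on vertex set $T$, every such $k$-coloring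 is the label of exactly one node of $H$, and two nodes are adjacent iff their labels differ on exactly one element of $T$. A labeled graph $(H,\ell)$ satisfies the injective neighborhood property (INP) if for every node $u$ and any two distinct neighbors $v,w$ of $u$, $\ell(v)\ne\ell(w)$. *)

theory Defs
  imports "HOL-Library.FuncSet"
begin

section \<open>Simple graphs\<close>

text \<open>A finite simple graph on vertex set V with edge set E (2-element subsets of V).\<close>
definition simple_graph :: "'a set \<Rightarrow> 'a set set \<Rightarrow> bool" where
  "simple_graph V E \<longleftrightarrow> finite V \<and>
     (\<forall>e\<in>E. \<exists>u v. e = {u, v} \<and> u \<noteq> v \<and> u \<in> V \<and> v \<in> V)"

definition is_clique :: "'a set \<Rightarrow> 'a set set \<Rightarrow> 'a set \<Rightarrow> bool" where
  "is_clique V E T \<longleftrightarrow> T \<subseteq> V \<and> (\<forall>u\<in>T. \<forall>v\<in>T. u \<noteq> v \<longrightarrow> {u, v} \<in> E)"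

text \<open>Chordal: no induced cycle of length greater than 3.\<close>
definition chordal :: "'a set \<Rightarrow> 'a set set \<Rightarrow> bool" where
  "chordal V E \<longleftrightarrow> \<not> (\<exists>cs. length cs \<ge> 4 \<and> distinct cs \<and> set cs \<subseteq> V \<and>
      (\<forall>i<length cs. \<forall>j<length cs.
         {cs ! i, cs ! j} \<in> E \<longleftrightarrow>
           (j = (i + 1) mod length cs \<or> i = (j + 1) mod length cs)))"

text \<open>Vertex cut: removing S leaves two vertices not joined by a path.\<close>
definition vertex_cut :: "'a set \<Rightarrow> 'a set set \<Rightarrow> 'a set \<Rightarrow> bool" where
  "vertex_cut V E S \<longleftrightarrow> S \<subseteq> V \<and>
     (\<exists>u\<in>V - S. \<exists>v\<in>V - S.
        (u, v) \<notin> {(x, y). {x, y} \<in> E \<and> x \<in> V - S \<and> y \<in> V - S}\<^sup>*)"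

definition l_connected :: "nat \<Rightarrow> 'a set \<Rightarrow> 'a set set \<Rightarrow> bool" where
  "l_connected l V E \<longleftrightarrow> card V \<ge> l + 1 \<and> (\<forall>S. vertex_cut V E S \<longrightarrow> card S \<ge> l)"

section \<open>Colorings and the color graph\<close>

text \<open>k-colorings as extensional maps V \<rightarrow> {1..k}.\<close>
definition colorings :: "'a set \<Rightarrow> 'a set set \<Rightarrow> nat \<Rightarrow> ('a \<Rightarrow> nat) set" where
  "colorings V E k = {\<alpha> \<in> V \<rightarrow>\<^sub>E {1..k}. \<forall>u v. {u, v} \<in> E \<longrightarrow> \<alpha> u \<noteq> \<alpha> v}"

definition colorable :: "'a set \<Rightarrow> 'a set set \<Rightarrow> nat \<Rightarrow> bool" where
  "colorable V E k \<longleftrightarrow> colorings V E k \<noteq> {}"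

text \<open>Adjacency in the k-color graph: differ on exactly one vertex.\<close>
definition col_adj :: "'a set \<Rightarrow> ('a \<Rightarrow> nat) \<Rightarrow> ('a \<Rightarrow> nat) \<Rightarrow> bool" where
  "col_adj V \<alpha> \<beta> \<longleftrightarrow> card {v \<in> V. \<alpha> v \<noteq> \<beta> v} = 1"

definition induces_connected :: "'a set \<Rightarrow> ('a \<Rightarrow> nat) set \<Rightarrow> bool" where
  "induces_connected V Ss \<longleftrightarrow> Ss \<noteq> {} \<and>
     (\<forall>\<alpha>\<in>Ss. \<forall>\<beta>\<in>Ss. (\<alpha>, \<beta>) \<in> {(x, y). x \<in> Ss \<and> y \<in> Ss \<and> col_adj V x y}\<^sup>*)"

definition same_label :: "'a set \<Rightarrow> ('a \<Rightarrow> nat) set \<Rightarrow> bool" where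
  "same_label T Ss \<longleftrightarrow> (\<forall>\<alpha>\<in>Ss. \<forall>\<beta>\<in>Ss. restrict \<alpha> T = restrict \<beta> T)"

definition label_component ::
  "'a set \<Rightarrow> 'a set set \<Rightarrow> nat \<Rightarrow> 'a set \<Rightarrow> ('a \<Rightarrow> nat) set \<Rightarrow> bool" where
  "label_component V E k T Ss \<longleftrightarrow>
     Ss \<subseteq> colorings V E k \<and> same_label T Ss \<and> induces_connected V Ss \<and>
     \<not> (\<exists>Ss'. Ss \<subset> Ss' \<and> Ss' \<subseteq> colorings V E k \<and> same_label T Ss' \<and> induces_connected V Ss')"

section \<open>Contracted solution graph (nodes are the label components themselves)\<close>

definition csg_nodes :: "'a set \<Rightarrow> 'a set set \<Rightarrow> nat \<Rightarrow> 'a set \<Rightarrow> ('a \<Rightarrow> nat) set set" where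
  "csg_nodes V E k T = {Ss. label_component V E k T Ss}"

definition csg_edges ::
  "'a set \<Rightarrow> 'a set set \<Rightarrow> nat \<Rightarrow> 'a set \<Rightarrow> ('a \<Rightarrow> nat) set set set" where
  "csg_edges V E k T = {{S, S'} | S S'. S \<in> csg_nodes V E k T \<and> S' \<in> csg_nodes V E k T \<and>
       S \<noteq> S' \<and> (\<exists>\<gamma>\<in>S. \<exists>\<gamma>'\<in>S'. col_adj V \<gamma> \<gamma>')}"

definition csg_label :: "'a set \<Rightarrow> ('a \<Rightarrow> nat) set \<Rightarrow> ('a \<Rightarrow> nat)" where
  "csg_label T S = restrict (SOME \<gamma>. \<gamma> \<in> S) T"

section \<open>Properties of labeled graphs (N nodes, A edges, lab labels)\<close>

definition complete_colorings :: "'a set \<Rightarrow> nat \<Rightarrow> ('a \<Rightarrow> nat) set" where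
  "complete_colorings T k = {c \<in> T \<rightarrow>\<^sub>E {1..k}. inj_on c T}"

definition color_complete ::
  "nat \<Rightarrow> nat \<Rightarrow> 'n set \<Rightarrow> 'n set set \<Rightarrow> ('n \<Rightarrow> ('a \<Rightarrow> nat)) \<Rightarrow> bool" where
  "color_complete m k N A lab \<longleftrightarrow> (\<exists>T. finite T \<and> card T = m \<and>
     (\<forall>x\<in>N. lab x \<in> complete_colorings T k) \<and>
     (\<forall>c\<in>complete_colorings T k. \<exists>!x. x \<in> N \<and> lab x = c) \<and>
     (\<forall>x\<in>N. \<forall>y\<in>N. {x, y} \<in> A \<longleftrightarrow> card {t \<in> T. lab x t \<noteq> lab y t} = 1))"

definition forest :: "'n set \<Rightarrow> 'n set set \<Rightarrow> bool" where
  "forest N A \<longleftrightarrow> \<not> (\<exists>cs. length cs \<ge> 3 \<and> distinct cs \<and> set cs \<subseteq> N \<and>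
      (\<forall>i<length cs. {cs ! i, cs ! ((i + 1) mod length cs)} \<in> A))"

definition INP :: "'n set \<Rightarrow> 'n set set \<Rightarrow> ('n \<Rightarrow> 'b) \<Rightarrow> bool" where
  "INP N A lab \<longleftrightarrow> (\<forall>u\<in>N. \<forall>v\<in>N. \<forall>w\<in>N.
     {u, v} \<in> A \<and> {u, w} \<in> A \<and> v \<noteq> w \<longrightarrow> lab v \<noteq> lab w)"

end

theory Submission
  imports Defs
begin

text \<open>Let \<open>l = k - 2\<close>. By Dirac's theorem on simplicial vertices, \<open>G\<close> arises from an \<open>(l + 1)\<close>-clique
  by repeatedly attaching a vertex to a clique with at least \<open>l\<close> elements. Hence every vertex lies in
  an \<open>(l + 1)\<close>-clique, so it has at most one alternative colour at any time, and two such cliques are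
  linked by a chain of \<open>(l + 1)\<close>-cliques that contain their intersection and consecutively share at
  least \<open>l\<close> vertices.

  If \<open>G\<close> has no \<open>k\<close>-clique, it can be built from \<open>T\<close> by attaching vertices of degree exactly \<open>l\<close>, which
  can always give way, so recolourings of \<open>T\<close> lift to \<open>G\<close> and the graph is colour-complete. A \<open>k\<close>-clique,
  on the other hand, is frozen. Describe a walk in the colour graph by the word of recoloured vertices.
  If \<open>v B v\<close> occurs in it and \<open>B\<close> misses an \<open>(l + 1)\<close>-clique through \<open>v\<close>, then some pair of equal letters
  can be deleted from the word without changing the end points of the walk. A nonempty closed walk
  always contains such a pair, so closed walks reduce to the empty word. As a deletion preserves the
  parity with which an edge of the contracted graph is crossed, that graph has no cycles. Reducing the
  walk that witnesses two equally labelled neighbours of a node gives the injective neighbourhood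
  property.\<close>

section \<open>Simplicial vertices of chordal graphs\<close>

definition nbrs :: "'a set set \<Rightarrow> 'a set \<Rightarrow> 'a \<Rightarrow> 'a set" where
  "nbrs E W v = {u \<in> W. {u, v} \<in> E}"

definition ind_rel :: "'a set set \<Rightarrow> 'a set \<Rightarrow> ('a \<times> 'a) set" where
  "ind_rel E W = {(x, y). {x, y} \<in> E \<and> x \<in> W \<and> y \<in> W}"

definition conn_set :: "'a set set \<Rightarrow> 'a set \<Rightarrow> bool" where
  "conn_set E X \<longleftrightarrow> (\<forall>x\<in>X. \<forall>y\<in>X. (x, y) \<in> (ind_rel E X)\<^sup>*)"

definition far :: "'a set set \<Rightarrow> 'a set \<Rightarrow> 'a set \<Rightarrow> 'a set" where
  "far E W X = {r \<in> W. r \<notin> X \<and> (\<forall>x\<in>X. {x, r} \<notin> E)}"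

lemma ind_rel_mono: "X \<subseteq> Y \<Longrightarrow> ind_rel E X \<subseteq> ind_rel E Y"
  by (auto simp: ind_rel_def)

lemma chordal_subset: "chordal V E \<Longrightarrow> W \<subseteq> V \<Longrightarrow> chordal W E"
  unfolding chordal_def by (meson order_trans)

lemma is_clique_subset: "is_clique V E Q \<Longrightarrow> X \<subseteq> Q \<Longrightarrow> is_clique V E X"
  unfolding is_clique_def by blast

lemma conn_set_insert:
  assumes X: "conn_set E X" and x: "x \<in> X" "{x, s} \<in> E"
  shows "conn_set E (insert s X)"
proof -
  let ?R = "ind_rel E (insert s X)"
  have mono: "(y, z) \<in> ?R\<^sup>*" if "y \<in> X" "z \<in> X" for y z
    using X that rtrancl_mono[OF ind_rel_mono[of X "insert s X" E]] unfolding conn_set_def by blast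
  have sx: "(s, x) \<in> ?R" "(x, s) \<in> ?R"
    using x by (auto simp: ind_rel_def insert_commute)
  have "(y, s) \<in> ?R\<^sup>*" "(s, y) \<in> ?R\<^sup>*" if "y \<in> X" for y
    using mono[OF that x(1)] mono[OF x(1) that] sx by (auto intro: rtrancl_into_rtrancl converse_rtrancl_into_rtrancl)
  with mono show ?thesis unfolding conn_set_def by auto
qed

text \<open>A walk of least length has no shortcuts: a forward relation between nonconsecutive
  points, or a repeated point, would give a shorter one. For a symmetric relation this is an induced
  path.\<close>

lemma shortest_path:
  assumes "(s, t) \<in> R\<^sup>*"
  obtains f and n :: nat where "f 0 = s" "f n = t"
    "\<And>i. i < n \<Longrightarrow> (f i, f (Suc i)) \<in> R"
    "\<And>i j. i < j \<Longrightarrow> j \<le> n \<Longrightarrow> (f i, f j) \<in> R \<Longrightarrow> j = Suc i"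
    "inj_on f {..n}"
proof -
  define n where "n = (LEAST n. (s, t) \<in> R ^^ n)"
  have n: "(s, t) \<in> R ^^ n" 
    unfolding n_def using assms rtrancl_imp_relpow LeastI_ex by (metis (mono_tags, lifting))
  have least: "n \<le> m" if "(s, t) \<in> R ^^ m" for m
    unfolding n_def using that by (rule Least_le)
  obtain f where f: "f 0 = s" "f n = t" "\<And>i. i < n \<Longrightarrow> (f i, f (Suc i)) \<in> R"
    using n unfolding relpow_fun_conv by blast
  have pow: "(f i, f j) \<in> R ^^ (j - i)" if "i \<le> j" "j \<le> n" for i j
    unfolding relpow_fun_conv using f(3) that
    by (intro exI[of _ "\<lambda>m. f (i + m)"]) auto
  have short: "j = Suc i" if ij: "i < j" "j \<le> n" and R: "(f i, f j) \<in> R" for i j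
  proof -
    have "(f 0, f j) \<in> R ^^ Suc i"
      using pow[of 0 i] ij R by auto
    then have "(s, t) \<in> R ^^ (Suc i + (n - j))"
      using pow[of j n] ij f(1,2) by (metis le_refl relpow_add relcomp.relcompI)
    from least[OF this] ij show ?thesis by linarith
  qed
  have "f i \<noteq> f j" if ij: "i < j" "j \<le> n" for i j
  proof
    assume eq: "f i = f j"
    have "(f 0, f i) \<in> R ^^ i"
      using pow[of 0 i] ij by auto
    then have "(s, t) \<in> R ^^ (i + (n - j))"
      using pow[of j n] ij f(1,2) eq by (metis le_refl relpow_add relcomp.relcompI)
    from least[OF this] ij show False by linarith
  qed
  then have "inj_on f {..n}"
    by (intro linorder_inj_onI') auto
  with f short show ?thesis using that by blast
qed

text \<open>If \<open>s\<close> and \<open>t\<close> were not adjacent, a shortest path between them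
  with interior in \<open>X\<close> would have length at least 2, and \<open>r\<close>, which sees
  \<open>s\<close> and \<open>t\<close> but nothing in \<open>X\<close>, would close it to an
  induced cycle of length at least 4.\<close>

lemma chordal_separator_adjacent:
  assumes ch: "chordal W E" and X: "conn_set E X" "X \<subseteq> W"
    and s: "s \<in> W" "x \<in> X" "{x, s} \<in> E" and t: "t \<in> W" "y \<in> X" "{y, t} \<in> E"
    and st: "s \<noteq> t" "s \<notin> X" "t \<notin> X"
    and r: "r \<in> far E W X" "{s, r} \<in> E" "{t, r} \<in> E" and loopless: "\<And>v. {v} \<notin> E"
  shows "{s, t} \<in> E"
proof (rule ccontr)
  assume nst: "{s, t} \<notin> E"
  have "conn_set E (insert t (insert s X))"
    using conn_set_insert[OF conn_set_insert[OF X(1) s(2,3)], of y t] t by auto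
  then have "(s, t) \<in> (ind_rel E (insert t (insert s X)))\<^sup>*"
    unfolding conn_set_def by blast
  from shortest_path[OF this] obtain f and n :: nat where f: "f 0 = s" "f n = t"
    "\<And>i. i < n \<Longrightarrow> (f i, f (Suc i)) \<in> ind_rel E (insert t (insert s X))"
    "\<And>i j. i < j \<Longrightarrow> j \<le> n \<Longrightarrow> (f i, f j) \<in> ind_rel E (insert t (insert s X)) \<Longrightarrow> j = Suc i"
    "inj_on f {..n}" by metis
  have n0: "n \<noteq> 0" using f(1,2) st(1) by metis
  have n1: "n \<noteq> 1" using f(1,2) f(3)[of 0] nst by (auto simp: ind_rel_def)
  have rX: "r \<in> W" "r \<notin> X" "\<And>x. x \<in> X \<Longrightarrow> {x, r} \<notin> E"
    using r(1) by (auto simp: far_def)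
  have rst: "r \<noteq> s" "r \<noteq> t" using r(2,3) loopless by force+
  have fin: "f i \<in> insert t (insert s X)" if "i \<le> n" for i
    using f(3)[of i] that f(2) by (cases "i = n") (auto simp: ind_rel_def)
  have fX: "f i \<in> X" if "0 < i" "i < n" for i
    using fin[of i] inj_onD[OF f(5), of i 0] inj_onD[OF f(5), of i n] that f(1,2) by auto
  have ff: "{f i, f j} \<in> E \<longleftrightarrow> j = Suc i \<or> i = Suc j" if ij: "i \<le> n" "j \<le> n" for i j
  proof -
    have less: "{f i, f j} \<in> E \<longleftrightarrow> j = Suc i" if ij: "i < j" "j \<le> n" for i j
    proof
      assume "{f i, f j} \<in> E"
      then have "(f i, f j) \<in> ind_rel E (insert t (insert s X))"
        unfolding ind_rel_def using fin[of i] fin[of j] ij by auto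
      then show "j = Suc i" using f(4) ij by blast
    next
      assume "j = Suc i"
      then show "{f i, f j} \<in> E" using f(3)[of i] ij by (auto simp: ind_rel_def)
    qed
    show ?thesis
      using less[of i j] less[of j i] ij loopless[of "f i"]
      by (cases i j rule: linorder_cases) (auto simp: insert_commute)
  qed
  have rf: "{f i, r} \<in> E \<longleftrightarrow> i = 0 \<or> i = n" if "i \<le> n" for i
    using fX[of i] rX(3) r(2,3) f(1,2) that by (cases "i = 0 \<or> i = n") auto
  have rfne: "f i \<noteq> r" if "i \<le> n" for i
    using fin[OF that] rX(2) rst by auto
  \<comment> \<open>The vertex \<open>r\<close> gets index 0 and \<open>f i\<close> gets index
    \<open>i + 1\<close>, so the cycle has length \<open>n + 2\<close> and the pair that wraps
    around is \<open>f n\<close>, \<open>r\<close>.\<close>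
  define cs where "cs = r # map f [0..<Suc n]"
  have len: "length cs = n + 2" by (simp add: cs_def)
  have nth: "cs ! Suc i = f i" "cs ! 0 = r" if "i \<le> n" for i
    using that by (auto simp: cs_def simp del: upt_Suc)
  have "length cs \<ge> 4" using len n0 n1 by linarith
  moreover have "distinct cs"
    using f(5) rfne unfolding cs_def
    by (auto simp: distinct_map atLeastLessThanSuc_atLeastAtMost atLeast0AtMost simp del: upt_Suc)
  moreover have "f i \<in> W" if "i \<le> n" for i
    using fin[OF that] s(1) t(1) X(2) by auto
  then have "set cs \<subseteq> W"
    using rX(1) unfolding cs_def by (auto simp del: upt_Suc)
  moreover have "{cs ! i, cs ! j} \<in> E \<longleftrightarrow> (j = (i + 1) mod length cs \<or> i = (j + 1) mod length cs)"
    if ij: "i < length cs" "j < length cs" for i j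
  proof (cases i)
    case 0
    show ?thesis
    proof (cases j)
      case (Suc j')
      then have "{cs ! i, cs ! j} \<in> E \<longleftrightarrow> j' = 0 \<or> j' = n"
        using rf[of j'] ij len 0 nth[of j'] by (auto simp: insert_commute)
      then show ?thesis using ij len 0 Suc n0 by (auto simp: mod_Suc)
    qed (use 0 loopless len nth in auto)
  next
    case (Suc i')
    show ?thesis
    proof (cases j)
      case 0
      then have "{cs ! i, cs ! j} \<in> E \<longleftrightarrow> i' = 0 \<or> i' = n"
        using rf[of i'] ij len Suc nth[of i'] by auto
      then show ?thesis using ij len 0 Suc n0 by (auto simp: mod_Suc)
    next
      case (Suc j')
      then have "{cs ! i, cs ! j} \<in> E \<longleftrightarrow> j' = Suc i' \<or> i' = Suc j'"
        using ff[of i' j'] ij len \<open>i = Suc i'\<close> nth[of i'] nth[of j'] by auto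
      then show ?thesis using ij len Suc \<open>i = Suc i'\<close> by (auto simp: mod_Suc)
    qed
  qed
  ultimately show False using ch unfolding chordal_def by blast
qed

text \<open>Dirac's theorem, together with a version that places the vertex away from
  \<open>X\<close>. Enlarge \<open>X\<close> to a largest connected \<open>Y\<close> that still has
  far vertices \<open>R\<close>. The boundary \<open>S\<close> is then joined completely to
  \<open>R\<close> and is a clique, so a simplicial vertex of the smaller graph on \<open>R\<close>
  stays simplicial in \<open>W\<close>. The first part follows by taking for \<open>X\<close> a
  single vertex that has a non-neighbour.\<close>

lemma chordal_simplicial:
  assumes "finite W" "chordal W E" "W \<noteq> {}" and loopless: "\<And>v. {v} \<notin> E"
  shows "(\<exists>v\<in>W. is_clique W E (nbrs E W v)) \<and>
    (\<forall>X\<subseteq>W. X \<noteq> {} \<longrightarrow> conn_set E X \<longrightarrow> far E W X \<noteq> {} \<longrightarrow>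
      (\<exists>v\<in>far E W X. is_clique W E (nbrs E W v)))"
  using assms(1-3)
proof (induction W rule: finite_psubset_induct)
  case (psubset W)
  have outside: "\<exists>v\<in>far E W X. is_clique W E (nbrs E W v)"
    if X: "X \<subseteq> W" "X \<noteq> {}" "conn_set E X" "far E W X \<noteq> {}" for X
  proof -
    let ?P = "\<lambda>Y. X \<subseteq> Y \<and> Y \<subseteq> W \<and> conn_set E Y \<and> far E W Y \<noteq> {}"
    have "\<exists>Y. ?P Y \<and> (\<forall>Z. ?P Z \<longrightarrow> card Z \<le> card Y)"
      by (rule ex_has_greatest_nat[of ?P X card "Suc (card W)"])
         (use X psubset.hyps in \<open>auto simp: card_mono le_imp_less_Suc\<close>)
    then obtain Y where Y: "?P Y" and max: "\<And>Z. ?P Z \<Longrightarrow> card Z \<le> card Y" by blast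
    define R where "R = far E W Y"
    define S where "S = W - Y - R"
    have RW: "R \<subseteq> W" "R \<inter> Y = {}" "R \<noteq> {}" using Y by (auto simp: R_def far_def)
    have SY: "\<exists>x\<in>Y. {x, s} \<in> E" if "s \<in> S" for s
      using that by (auto simp: S_def R_def far_def)
    \<comment> \<open>Otherwise \<open>s\<close> could be added to \<open>Y\<close> with
      \<open>r\<close> still far away, against the maximality of \<open>Y\<close>.\<close>
    have SR: "{s, r} \<in> E" if s: "s \<in> S" and r: "r \<in> R" for s r
    proof (rule ccontr)
      assume "{s, r} \<notin> E"
      then have "r \<in> far E W (insert s Y)"
        using s r by (auto simp: far_def S_def R_def)
      moreover have "conn_set E (insert s Y)"
        using SY[OF s] conn_set_insert Y by metis
      ultimately have "?P (insert s Y)" using Y s by (auto simp: S_def)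
      then have "card (insert s Y) \<le> card Y" by (rule max)
      moreover have "finite Y" using Y psubset.hyps finite_subset by blast
      ultimately show False using s by (auto simp: S_def)
    qed
    have SS: "{s, t} \<in> E" if st: "s \<in> S" "t \<in> S" "s \<noteq> t" for s t
    proof -
      obtain r where r: "r \<in> R" using RW by blast
      obtain x y where "x \<in> Y" "{x, s} \<in> E" "y \<in> Y" "{y, t} \<in> E"
        using SY[OF st(1)] SY[OF st(2)] by blast
      then show ?thesis
        using chordal_separator_adjacent[of W E Y s x t y r] psubset.prems(1) Y st SR r loopless
        by (auto simp: S_def R_def)
    qed
    have "R \<subset> W" using RW Y X by blast
    from psubset.IH[OF this] obtain v where v: "v \<in> R" "is_clique R E (nbrs E R v)"
      using chordal_subset psubset.prems RW by metis
    have "{a, b} \<in> E" if "a \<in> nbrs E W v" "b \<in> nbrs E W v" "a \<noteq> b" for a b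
    proof -
      have *: "c \<in> nbrs E R v \<or> c \<in> S" if "c \<in> nbrs E W v" for c
        using that v by (auto simp: nbrs_def S_def R_def far_def)
      have "nbrs E R v \<subseteq> R" by (auto simp: nbrs_def)
      then show ?thesis
        using *[OF that(1)] *[OF that(2)] v(2) SS SR that(3)
        by (auto simp: is_clique_def insert_commute) (metis insert_commute subsetD)+
    qed
    then have "is_clique W E (nbrs E W v)" by (auto simp: is_clique_def nbrs_def)
    moreover have "v \<in> far E W X" using v Y by (auto simp: R_def far_def)
    ultimately show ?thesis by blast
  qed
  have "\<exists>v\<in>W. is_clique W E (nbrs E W v)"
  proof (cases "is_clique W E W")
    case True
    then show ?thesis using psubset.prems(2) by (auto simp: is_clique_def nbrs_def)
  next
    case False
    then obtain u w where uw: "u \<in> W" "w \<in> W" "u \<noteq> w" "{u, w} \<notin> E"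
      by (auto simp: is_clique_def)
    then show ?thesis
      using outside[of "{u}"] by (auto simp: conn_set_def far_def)
  qed
  with outside show ?case by blast
qed

text \<open>If some \<open>t\<close> in \<open>T\<close> has a non-neighbour, a simplicial vertex
  far from \<open>t\<close> avoids the clique \<open>T\<close>. Otherwise \<open>T\<close> is joined
  to everything, and a simplicial vertex that has a non-neighbour avoids \<open>T\<close>. Thus
  vertices can be stripped off while \<open>T\<close> is kept.\<close>

lemma simplicial_outside_clique:
  assumes W: "finite W" "chordal W E" and loopless: "\<And>v. {v} \<notin> E"
    and T: "is_clique W E T" "T \<noteq> W"
  shows "\<exists>v\<in>W - T. is_clique W E (nbrs E W v)"
proof (cases "is_clique W E W")
  case True
  then show ?thesis using T by (auto simp: is_clique_def nbrs_def)
next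
  case False
  then obtain u w where uw: "u \<in> W" "w \<in> W" "u \<noteq> w" "{u, w} \<notin> E"
    by (auto simp: is_clique_def)
  have W0: "W \<noteq> {}" using uw by blast
  have out: "\<exists>v\<in>far E W {x}. is_clique W E (nbrs E W v)"
    if "x \<in> W" "y \<in> W" "x \<noteq> y" "{x, y} \<notin> E" for x y
  proof -
    have "conn_set E {x}" "y \<in> far E W {x}" using that by (auto simp: far_def conn_set_def)
    then show ?thesis
      using conjunct2[OF chordal_simplicial[OF W W0 loopless], rule_format, of "{x}"] that by blast
  qed
  show ?thesis
  proof (cases "\<exists>t\<in>T. \<exists>y\<in>W. t \<noteq> y \<and> {t, y} \<notin> E")
    case True
    then obtain t y where t: "t \<in> T" "y \<in> W" "t \<noteq> y" "{t, y} \<notin> E" by blast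
    then obtain v where v: "v \<in> far E W {t}" "is_clique W E (nbrs E W v)"
      using out[of t y] T by (auto simp: is_clique_def)
    moreover have "v \<notin> T" using v(1) t T(1) by (auto simp: far_def is_clique_def)
    ultimately show ?thesis by (auto simp: far_def)
  next
    case False
    obtain v where v: "v \<in> far E W {u}" "is_clique W E (nbrs E W v)"
      using out[of u w] uw by blast
    then have "{v, u} \<notin> E" "v \<noteq> u" by (auto simp: far_def insert_commute)
    then have "v \<notin> T" using False uw(1) by blast
    with v show ?thesis by (auto simp: far_def)
  qed
qed

section \<open>Attaching simplicial vertices\<close>

text \<open>A path can skip \<open>v\<close>, because the vertices before and after \<open>v\<close>
  are equal or adjacent.\<close>

lemma simplicial_remove_reach:
  assumes simp: "is_clique W E (nbrs E W v)" and reach: "(u, y) \<in> (ind_rel E (W - S))\<^sup>*"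
    and u: "u \<noteq> v" and y: "y \<noteq> v"
  shows "(u, y) \<in> (ind_rel E (W - {v} - S))\<^sup>*"
proof -
  let ?R = "ind_rel E (W - {v} - S)"
  \<comment> \<open>While the path stands at \<open>v\<close>, the induction remembers a neighbour
    of \<open>v\<close> outside \<open>S\<close> that was reached without \<open>v\<close>.\<close>
  from reach have "(y \<noteq> v \<longrightarrow> (u, y) \<in> ?R\<^sup>*) \<and>
      (y = v \<longrightarrow> (\<exists>z\<in>nbrs E W v - S - {v}. (u, z) \<in> ?R\<^sup>*))"
  proof (induction rule: rtrancl_induct)
    case base
    then show ?case using u by auto
  next
    case (step y z)
    then have yz: "{y, z} \<in> E" "y \<in> W - S" "z \<in> W - S" by (auto simp: ind_rel_def)
    show ?case
    proof (cases "z = v")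
      case True
      show ?thesis
      proof (cases "y = v")
        case False
        then have "y \<in> nbrs E W v - S - {v}" using yz True by (auto simp: nbrs_def)
        then show ?thesis using step.IH True False by auto
      qed (use True step.IH in auto)
    next
      case False
      show ?thesis
      proof (cases "y = v")
        case True
        then obtain x where x: "x \<in> nbrs E W v - S - {v}" "(u, x) \<in> ?R\<^sup>*"
          using step.IH by auto
        have "z \<in> nbrs E W v" using yz True by (auto simp: nbrs_def insert_commute)
        then have "x = z \<or> {x, z} \<in> E" using simp x by (auto simp: is_clique_def)
        then have "x = z \<or> (x, z) \<in> ?R"
          using x(1) yz False by (auto simp: ind_rel_def nbrs_def)
        then show ?thesis using x(2) False by auto
      next
        case False
        then have "(y, z) \<in> ?R" using yz \<open>z \<noteq> v\<close> by (auto simp: ind_rel_def)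
        then show ?thesis using False \<open>z \<noteq> v\<close> step.IH by auto
      qed
    qed
  qed
  with y show ?thesis by blast
qed

text \<open>By \<open>simplicial_remove_reach\<close>, a vertex cut of the smaller graph is one of
  the larger graph too.\<close>

lemma l_connected_remove_simplicial:
  assumes conn: "l_connected l W E" and simp: "is_clique W E (nbrs E W v)"
    and card: "card (W - {v}) \<ge> l + 1"
  shows "l_connected l (W - {v}) E"
proof -
  have "card S \<ge> l" if cut: "vertex_cut (W - {v}) E S" for S
  proof -
    obtain u y where uy: "u \<in> W - {v} - S" "y \<in> W - {v} - S" "S \<subseteq> W - {v}"
        "(u, y) \<notin> (ind_rel E (W - {v} - S))\<^sup>*"
      using cut unfolding vertex_cut_def ind_rel_def by blast
    then have "(u, y) \<notin> (ind_rel E (W - S))\<^sup>*"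
      using simplicial_remove_reach[OF simp] by blast
    then have "vertex_cut W E S"
      using uy unfolding vertex_cut_def ind_rel_def by blast
    then show ?thesis using conn by (auto simp: l_connected_def)
  qed
  with card show ?thesis by (auto simp: l_connected_def)
qed

text \<open>Either \<open>v\<close> is adjacent to all other vertices, of which there are at least
  \<open>l\<close>, or its neighbourhood separates it from a non-neighbour and is a vertex
  cut.\<close>

lemma l_connected_degree:
  assumes conn: "l_connected l W E" and v: "v \<in> W" and fin: "finite W"
    and loopless: "\<And>v. {v} \<notin> E"
  shows "l \<le> card (nbrs E W v)"
proof (cases "insert v (nbrs E W v) = W")
  case True
  then have "card W \<le> Suc (card (nbrs E W v))"
    using card_insert_le_m1 by (metis card_insert_if fin finite_insert le_Suc_eq order_refl)
  then show ?thesis using conn by (auto simp: l_connected_def)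
next
  case False
  then obtain u where u: "u \<in> W" "u \<noteq> v" "u \<notin> nbrs E W v"
    using v by (auto simp: nbrs_def)
  have vn: "v \<notin> nbrs E W v" using loopless by (auto simp: nbrs_def)
  have "y = v" if "(v, y) \<in> (ind_rel E (W - nbrs E W v))\<^sup>*" for y
    using that
  proof (induction rule: rtrancl_induct)
    case (step y z)
    then show ?case by (auto simp: ind_rel_def nbrs_def insert_commute)
  qed simp
  then have "(v, u) \<notin> (ind_rel E (W - nbrs E W v))\<^sup>*" using u by blast
  moreover have "nbrs E W v \<subseteq> W" by (auto simp: nbrs_def)
  ultimately have "vertex_cut W E (nbrs E W v)"
    using u v vn unfolding vertex_cut_def ind_rel_def by blast
  then show ?thesis using conn by (auto simp: l_connected_def)
qed

text \<open>Read backwards, this is a perfect elimination order that stops at \<open>B\<close> and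
  in which every removed vertex has degree at least \<open>l\<close>. As \<open>v\<close> is not yet
  in \<open>W\<close>, \<open>nbrs E W v\<close> consists of its earlier neighbours.\<close>

inductive attach :: "nat \<Rightarrow> 'a set set \<Rightarrow> 'a set \<Rightarrow> 'a set \<Rightarrow> bool" for l E B where
  base: "attach l E B B"
| step: "attach l E B W \<Longrightarrow> v \<notin> W \<Longrightarrow> is_clique W E (nbrs E W v) \<Longrightarrow> l \<le> card (nbrs E W v) \<Longrightarrow>
    attach l E B (insert v W)"

lemma attach_trans: "attach l E B W \<Longrightarrow> attach l E A B \<Longrightarrow> attach l E A W"
  by (induction rule: attach.induct) (auto intro: attach.step)

lemma attach_subset: "attach l E B W \<Longrightarrow> B \<subseteq> W"
  by (induction rule: attach.induct) auto

lemma nbrs_remove: "{v} \<notin> E \<Longrightarrow> nbrs E (W - {v}) v = nbrs E W v"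
  by (auto simp: nbrs_def)

text \<open>Simplicial vertices outside \<open>T\<close> are removed until \<open>l + 1\<close>
  vertices remain. Connectivity survives each removal, and minimum degree \<open>l\<close> forces
  the remainder to be complete.\<close>

lemma attach_exists:
  assumes "finite W" "chordal W E" "l_connected l W E" "is_clique W E T" "card T \<le> l + 1"
    and loopless: "\<And>v. {v} \<notin> E"
  shows "\<exists>Q. is_clique W E Q \<and> card Q = l + 1 \<and> T \<subseteq> Q \<and> attach l E Q W"
  using assms(1-5)
proof (induction W rule: finite_psubset_induct)
  case (psubset W)
  have cW: "l + 1 \<le> card W" using psubset.prems by (auto simp: l_connected_def)
  show ?case
  proof (cases "card W = l + 1")
    case True
    have "nbrs E W v = W - {v}" if "v \<in> W" for v
    proof (rule card_subset_eq)
      show "nbrs E W v \<subseteq> W - {v}" using loopless by (auto simp: nbrs_def)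
      then have "card (nbrs E W v) \<le> l"
        using True card_mono[of "W - {v}"] that psubset.hyps by fastforce
      moreover have "l \<le> card (nbrs E W v)"
        using l_connected_degree[OF psubset.prems(2) that psubset.hyps loopless] .
      ultimately show "card (nbrs E W v) = card (W - {v})" using True that by simp
    qed (use psubset.hyps in simp)
    then have "is_clique W E W" by (auto simp: is_clique_def nbrs_def)
    moreover have "T \<subseteq> W" using psubset.prems(3) by (auto simp: is_clique_def)
    ultimately show ?thesis using True attach.base by blast
  next
    case False
    then have TW: "T \<noteq> W" using psubset.prems cW by auto
    obtain v where v: "v \<in> W" "v \<notin> T" "is_clique W E (nbrs E W v)"
      using simplicial_outside_clique[OF psubset.hyps psubset.prems(1) loopless psubset.prems(3) TW]
      by blast
    have "card (W - {v}) \<ge> l + 1" using cW False v by simp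
    then have conn: "l_connected l (W - {v}) E"
      by (rule l_connected_remove_simplicial[OF psubset.prems(2) v(3)])
    have T: "is_clique (W - {v}) E T"
      using psubset.prems(3) v by (auto simp: is_clique_def)
    have "W - {v} \<subset> W" using v by blast
    from psubset.IH[OF this chordal_subset[OF psubset.prems(1)] conn T psubset.prems(4)]
    obtain Q where Q: "is_clique (W - {v}) E Q" "card Q = l + 1" "T \<subseteq> Q" "attach l E Q (W - {v})"
      by auto
    have "is_clique (W - {v}) E (nbrs E (W - {v}) v)"
      using v(3) loopless unfolding nbrs_remove[OF loopless] is_clique_def by (auto simp: nbrs_def)
    moreover have "l \<le> card (nbrs E (W - {v}) v)"
      using l_connected_degree[OF psubset.prems(2) v(1) psubset.hyps loopless]
      by (simp add: nbrs_remove[OF loopless])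
    ultimately have "attach l E Q (insert v (W - {v}))"
      using Q(4) by (intro attach.step) auto
    then have "attach l E Q W" using v(1) by (simp add: insert_absorb)
    then show ?thesis using Q by (auto simp: is_clique_def)
  qed
qed

text \<open>Induction along the construction. If the last vertex \<open>v\<close> is in
  \<open>X\<close>, then \<open>X - {v}\<close> has at most \<open>l\<close> elements and lies in
  the clique of earlier neighbours of \<open>v\<close>, which has at least \<open>l\<close>; an
  \<open>l\<close>-set between the two is completed by \<open>v\<close>.\<close>

lemma clique_extend:
  assumes "attach l E B W" "is_clique W E B" "card B = l + 1" "finite W"
    and "is_clique W E X" "card X \<le> l + 1" and loopless: "\<And>v. {v} \<notin> E"
  shows "\<exists>Q. is_clique W E Q \<and> card Q = l + 1 \<and> X \<subseteq> Q"
  using assms(1-6)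
proof (induction arbitrary: X rule: attach.induct)
  case base
  then show ?case by (auto simp: is_clique_def)
next
  case (step W v)
  have B: "is_clique W E B" using step.prems(1) attach_subset[OF step.hyps(1)] by (auto simp: is_clique_def)
  show ?case
  proof (cases "v \<in> X")
    case False
    then have "is_clique W E X" using step.prems by (auto simp: is_clique_def)
    from step.IH[OF B step.prems(2) _ this step.prems(5)] step.prems(3)
    show ?thesis by (auto simp: is_clique_def)
  next
    case True
    let ?N = "nbrs E W v"
    have NW: "?N \<subseteq> W" by (auto simp: nbrs_def)
    have XN: "X - {v} \<subseteq> ?N"
      using step.prems(4) True unfolding is_clique_def nbrs_def by auto
    have fN: "finite ?N" using NW step.prems(3) finite_subset by auto
    have "finite X" using XN fN finite_subset by fastforce
    then have "card (X - {v}) \<le> l" using step.prems(5) True by simp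
    then obtain Y where Y: "X - {v} \<subseteq> Y" "Y \<subseteq> ?N" "card Y = l"
      using exists_subset_between[of "X - {v}" l ?N] XN fN step.hyps(4) by blast
    have "v \<notin> Y" "finite Y" using Y NW step.hyps(2) fN finite_subset by auto
    then have "card (insert v Y) = l + 1" using Y by simp
    moreover have "is_clique (insert v W) E (insert v Y)"
      using step.hyps(3) Y(2) by (auto simp: is_clique_def nbrs_def insert_commute)
    ultimately show ?thesis using Y(1) by blast
  qed
qed

section \<open>Chains of overlapping cliques\<close>

definition clique_steps :: "nat \<Rightarrow> 'a set \<Rightarrow> 'a set set \<Rightarrow> 'a set \<Rightarrow> ('a set \<times> 'a set) set" where
  "clique_steps l W E X = {(P, Q). is_clique W E P \<and> is_clique W E Q \<and>
     card P = l + 1 \<and> card Q = l + 1 \<and> X \<subseteq> P \<and> X \<subseteq> Q \<and> l \<le> card (P \<inter> Q)}"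

text \<open>Induction along the construction. A clique that contains the last vertex
  \<open>v\<close> is moved into the earlier graph by exchanging \<open>v\<close> and keeping the
  other \<open>l\<close> vertices. Two cliques that both contain \<open>v\<close> lie in a clique
  with at most \<open>l + 2\<close> vertices, so they share at least
  \<open>2 * (l + 1) - (l + 2) = l\<close> of them. The set \<open>X\<close> serves to pin a chain
  to a given vertex.\<close>

lemma clique_chain:
  assumes "attach l E B W" "is_clique W E B" "card B = l + 1" "finite W"
    and "is_clique W E P" "card P = l + 1" "X \<subseteq> P" and "is_clique W E Q" "card Q = l + 1" "X \<subseteq> Q"
    and "\<And>K. is_clique W E K \<Longrightarrow> card K \<le> l + 2" and loopless: "\<And>v. {v} \<notin> E"
  shows "(P, Q) \<in> (clique_steps l W E X)\<^sup>*"
  using assms(1-11)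
proof (induction arbitrary: X P Q rule: attach.induct)
  case base
  have "finite B" using base.prems by simp
  then have "P = B" "Q = B" using base.prems card_subset_eq[of B] by (auto simp: is_clique_def)
  then show ?case by simp
next
  case (step W v)
  let ?N = "nbrs E W v"
  let ?R = "clique_steps l (insert v W) E"
  have finW: "finite W" using step.prems(3) by simp
  have B: "is_clique W E B"
    using step.prems(1) attach_subset[OF step.hyps(1)] by (auto simp: is_clique_def)
  have mono: "(clique_steps l W E X)\<^sup>* \<subseteq> (?R X)\<^sup>*" for X
    by (rule rtrancl_mono) (auto simp: clique_steps_def is_clique_def)
  have sym: "sym (?R X)" for X by (auto simp: sym_def clique_steps_def Int_commute)
  have IH: "(P, Q) \<in> (?R X)\<^sup>*"
    if "is_clique W E P" "card P = l + 1" "X \<subseteq> P" "is_clique W E Q" "card Q = l + 1" "X \<subseteq> Q" for P Q X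
    using step.IH[OF B step.prems(2) finW that] step.prems(10) mono
    by (meson is_clique_def subset_iff subset_insertI2)
  have out: "\<exists>P'. is_clique W E P' \<and> card P' = l + 1 \<and> P - {v} \<subseteq> P' \<and> l \<le> card (P \<inter> P')"
    if P: "is_clique (insert v W) E P" "card P = l + 1" "v \<in> P" for P
  proof -
    have fP: "finite P" using P(2) by (metis Suc_eq_plus1 card.infinite nat.distinct(1))
    have "is_clique W E (P - {v})" "card (P - {v}) = l"
      using P fP by (auto simp: is_clique_def)
    then obtain P' where P': "is_clique W E P'" "card P' = l + 1" "P - {v} \<subseteq> P'"
      using clique_extend[OF step.hyps(1) B step.prems(2) finW _ _ loopless, of "P - {v}"] by auto
    have "card (P - {v}) \<le> card (P \<inter> P')"
      using P' fP by (intro card_mono) auto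
    with P' \<open>card (P - {v}) = l\<close> show ?thesis by auto
  qed
  have one: "(P, Q) \<in> (?R X)\<^sup>*"
    if P: "is_clique (insert v W) E P" "card P = l + 1" "X \<subseteq> P" "v \<in> P"
      and Q: "is_clique (insert v W) E Q" "card Q = l + 1" "X \<subseteq> Q" "v \<notin> Q" for P Q
  proof -
    obtain P' where P': "is_clique W E P'" "card P' = l + 1" "P - {v} \<subseteq> P'" "l \<le> card (P \<inter> P')"
      using out[OF P(1,2,4)] by blast
    \<comment> \<open>As \<open>v\<close> is not in \<open>Q\<close>, it is not in \<open>X\<close>,
      so the exchange of \<open>v\<close> preserves \<open>X\<close>.\<close>
    have X: "X \<subseteq> P'" using P' P Q by blast
    have "(P, P') \<in> ?R X" using P P' X by (auto simp: clique_steps_def is_clique_def)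
    moreover have "(P', Q) \<in> (?R X)\<^sup>*"
      using IH[OF P'(1,2) X, of Q] Q by (auto simp: is_clique_def)
    ultimately show ?thesis by (rule converse_rtrancl_into_rtrancl)
  qed
  show ?case
  proof (cases "v \<in> P"; cases "v \<in> Q")
    assume v: "v \<in> P" "v \<in> Q"
    have P: "P - {v} \<subseteq> ?N" and Q: "Q - {v} \<subseteq> ?N"
      using step.prems(4,7) v by (auto simp: is_clique_def nbrs_def)
    have "is_clique (insert v W) E (insert v ?N)"
      using step.hyps(3) by (auto simp: is_clique_def nbrs_def insert_commute)
    then have "card (insert v ?N) \<le> l + 2" by (rule step.prems(10))
    moreover have fN: "finite (insert v ?N)" using finW by (auto simp: nbrs_def)
    moreover have "P \<union> Q \<subseteq> insert v ?N" using P Q by blast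
    ultimately have "card (P \<union> Q) \<le> l + 2"
      using card_mono[OF fN] le_trans by blast
    moreover have "finite P" "finite Q" using P Q fN by (meson finite_subset finite_Diff2 finite.emptyI finite_insert)+
    ultimately have "l \<le> card (P \<inter> Q)"
      using card_Un_Int[of P Q] step.prems(5,8) by linarith
    then show ?thesis using step.prems by (auto simp: clique_steps_def)
  next
    assume "v \<in> P" "v \<notin> Q"
    then show ?thesis using one step.prems by blast
  next
    assume "v \<notin> P" "v \<in> Q"
    then have "(Q, P) \<in> (?R X)\<^sup>*" using one step.prems by blast
    then show ?thesis using sym_rtrancl[OF sym] by (meson symD)
  next
    assume "v \<notin> P" "v \<notin> Q"
    then have "is_clique W E P" "is_clique W E Q"
      using step.prems(4,7) unfolding is_clique_def by blast+
    then show ?thesis using IH[of P X Q] step.prems by blast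
  qed
qed

section \<open>Label components\<close>

text \<open>In contrast to \<open>col_adj\<close>, the recoloured vertex is named; it will be a
  letter of a word. Agreement at all other points includes those outside \<open>V\<close>, where
  colourings are \<open>undefined\<close>.\<close>

definition recolor :: "'a set \<Rightarrow> 'a set set \<Rightarrow> nat \<Rightarrow> 'a \<Rightarrow> ('a \<Rightarrow> nat) \<Rightarrow> ('a \<Rightarrow> nat) \<Rightarrow> bool" where
  "recolor V E k v \<gamma> \<delta> \<longleftrightarrow> \<gamma> \<in> colorings V E k \<and> \<delta> \<in> colorings V E k \<and> v \<in> V \<and>
     \<gamma> v \<noteq> \<delta> v \<and> (\<forall>u. u \<noteq> v \<longrightarrow> \<gamma> u = \<delta> u)"

definition label_rel :: "'a set \<Rightarrow> 'a set set \<Rightarrow> nat \<Rightarrow> 'a set \<Rightarrow> (('a \<Rightarrow> nat) \<times> ('a \<Rightarrow> nat)) set" where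
  "label_rel V E k T = {(\<gamma>, \<delta>). \<exists>v. v \<notin> T \<and> recolor V E k v \<gamma> \<delta>}"

definition component :: "'a set \<Rightarrow> 'a set set \<Rightarrow> nat \<Rightarrow> 'a set \<Rightarrow> ('a \<Rightarrow> nat) \<Rightarrow> ('a \<Rightarrow> nat) set" where
  "component V E k T \<gamma> = {\<delta>. (\<gamma>, \<delta>) \<in> (label_rel V E k T)\<^sup>*}"

lemma recolor_sym: "recolor V E k v \<gamma> \<delta> \<Longrightarrow> recolor V E k v \<delta> \<gamma>"
  by (auto simp: recolor_def)

lemma recolor_other: "recolor V E k v \<gamma> \<delta> \<Longrightarrow> u \<noteq> v \<Longrightarrow> \<delta> u = \<gamma> u"
  by (auto simp: recolor_def)

lemma colorings_outside: "\<gamma> \<in> colorings V E k \<Longrightarrow> v \<notin> V \<Longrightarrow> \<gamma> v = undefined"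
  by (auto simp: colorings_def PiE_def extensional_def)

lemma colorings_range: "\<gamma> \<in> colorings V E k \<Longrightarrow> v \<in> V \<Longrightarrow> \<gamma> v \<in> {1..k}"
  by (auto simp: colorings_def PiE_def)

lemma colorings_edge: "\<gamma> \<in> colorings V E k \<Longrightarrow> {u, v} \<in> E \<Longrightarrow> \<gamma> u \<noteq> \<gamma> v"
  by (auto simp: colorings_def)

lemma col_adj_iff_recolor:
  assumes "\<gamma> \<in> colorings V E k" "\<delta> \<in> colorings V E k"
  shows "col_adj V \<gamma> \<delta> \<longleftrightarrow> (\<exists>v. recolor V E k v \<gamma> \<delta>)"
proof
  assume "col_adj V \<gamma> \<delta>"
  then obtain v where v: "{v \<in> V. \<gamma> v \<noteq> \<delta> v} = {v}"
    unfolding col_adj_def card_1_singleton_iff One_nat_def by blast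
  then have "recolor V E k v \<gamma> \<delta>"
    using assms colorings_outside[of \<gamma>] colorings_outside[of \<delta>] unfolding recolor_def
    by (metis (mono_tags, lifting) mem_Collect_eq singleton_iff)
  then show "\<exists>v. recolor V E k v \<gamma> \<delta>" ..
next
  assume "\<exists>v. recolor V E k v \<gamma> \<delta>"
  then obtain v where "recolor V E k v \<gamma> \<delta>" ..
  then have "{u \<in> V. \<gamma> u \<noteq> \<delta> u} = {v}" by (auto simp: recolor_def)
  then show "col_adj V \<gamma> \<delta>" by (simp add: col_adj_def)
qed

lemma restrict_eq_recolor:
  assumes "recolor V E k v \<gamma> \<delta>"
  shows "restrict \<gamma> T = restrict \<delta> T \<longleftrightarrow> v \<notin> T"
  using assms unfolding recolor_def by (auto simp: restrict_def fun_eq_iff)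

lemma label_rel_eq:
  "label_rel V E k T = {(\<gamma>, \<delta>). \<gamma> \<in> colorings V E k \<and> \<delta> \<in> colorings V E k \<and>
     col_adj V \<gamma> \<delta> \<and> restrict \<gamma> T = restrict \<delta> T}"
  using col_adj_iff_recolor restrict_eq_recolor unfolding label_rel_def recolor_def
  by (auto 4 4 simp: col_adj_iff_recolor restrict_eq_recolor recolor_def)

lemma sym_label_rel: "sym (label_rel V E k T)"
  by (auto simp: sym_def label_rel_def dest: recolor_sym)

lemma component_eqI: "(\<gamma>, \<delta>) \<in> (label_rel V E k T)\<^sup>* \<Longrightarrow> component V E k T \<gamma> = component V E k T \<delta>"
  using symD[OF sym_rtrancl[OF sym_label_rel], of \<gamma> \<delta>] unfolding component_def
  by (meson Collect_cong rtrancl_trans)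

lemma component_self: "\<gamma> \<in> component V E k T \<gamma>"
  by (simp add: component_def)

lemma component_eq: "\<delta> \<in> component V E k T \<gamma> \<Longrightarrow> component V E k T \<delta> = component V E k T \<gamma>"
  using component_eqI unfolding component_def by fast

lemma component_recolor:
  "recolor V E k v \<gamma> \<delta> \<Longrightarrow> v \<notin> T \<Longrightarrow> component V E k T \<gamma> = component V E k T \<delta>"
  by (rule component_eqI) (auto simp: label_rel_def)

lemma label_rel_rtrancl:
  assumes "(\<gamma>, \<delta>) \<in> (label_rel V E k T)\<^sup>*"
  shows "restrict \<gamma> T = restrict \<delta> T" "\<gamma> \<in> colorings V E k \<Longrightarrow> \<delta> \<in> colorings V E k"
  using assms by (induction rule: rtrancl_induct) (auto simp: label_rel_eq)

lemma component_label: "\<delta> \<in> component V E k T \<gamma> \<Longrightarrow> restrict \<delta> T = restrict \<gamma> T"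
  using label_rel_rtrancl(1)[of \<gamma> \<delta>] by (simp add: component_def)

lemma component_colorings:
  "\<delta> \<in> component V E k T \<gamma> \<Longrightarrow> \<gamma> \<in> colorings V E k \<Longrightarrow> \<delta> \<in> colorings V E k"
  using label_rel_rtrancl(2)[of \<gamma> \<delta>] by (simp add: component_def)

text \<open>A connected set of equally labelled colourings lies in the reachability class of each of
  its elements, and that class is itself such a set. So the maximal sets are exactly the classes,
  and maximality disappears from the later arguments.\<close>

lemma label_component_iff:
  "label_component V E k T S \<longleftrightarrow> (\<exists>\<gamma>\<in>colorings V E k. S = component V E k T \<gamma>)"
proof -
  let ?C = "colorings V E k" and ?R = "label_rel V E k T"
  let ?ok = "\<lambda>S. S \<subseteq> ?C \<and> same_label T S \<and> induces_connected V S"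
  have sub: "S \<subseteq> component V E k T \<gamma>" if S: "?ok S" and \<gamma>: "\<gamma> \<in> S" for S \<gamma>
  proof
    fix \<delta> assume "\<delta> \<in> S"
    then have "(\<gamma>, \<delta>) \<in> {(x, y). x \<in> S \<and> y \<in> S \<and> col_adj V x y}\<^sup>*"
      using S \<gamma> by (auto simp: induces_connected_def)
    moreover have "{(x, y). x \<in> S \<and> y \<in> S \<and> col_adj V x y} \<subseteq> ?R"
      using S by (auto simp: label_rel_eq same_label_def)
    ultimately show "\<delta> \<in> component V E k T \<gamma>"
      unfolding component_def using rtrancl_mono by blast
  qed
  have ok: "?ok (component V E k T \<gamma>)" if \<gamma>: "\<gamma> \<in> ?C" for \<gamma>
  proof -
    let ?S = "component V E k T \<gamma>"
    have path: "(\<gamma>, \<delta>) \<in> {(x, y). x \<in> ?S \<and> y \<in> ?S \<and> col_adj V x y}\<^sup>*"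
      if "(\<gamma>, \<delta>) \<in> ?R\<^sup>*" for \<delta>
      using that
    proof (induction rule: rtrancl_induct)
      case (step y z)
      then have "y \<in> ?S" "z \<in> ?S" by (auto simp: component_def)
      with step show ?case by (auto simp: label_rel_eq intro: rtrancl_into_rtrancl)
    qed simp
    have sym: "sym {(x, y). x \<in> ?S \<and> y \<in> ?S \<and> col_adj V x y}"
      unfolding col_adj_def by (rule symI) (auto simp: eq_commute)
    have "(\<alpha>, \<beta>) \<in> {(x, y). x \<in> ?S \<and> y \<in> ?S \<and> col_adj V x y}\<^sup>*" if "\<alpha> \<in> ?S" "\<beta> \<in> ?S" for \<alpha> \<beta>
      using symD[OF sym_rtrancl[OF sym] path, of \<alpha>] path[of \<beta>] that
      by (auto simp: component_def intro: rtrancl_trans)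
    then have "induces_connected V ?S"
      using component_self[of \<gamma> V E k T] unfolding induces_connected_def by blast
    moreover have "same_label T ?S"
      unfolding same_label_def by (metis component_label)
    moreover have "?S \<subseteq> ?C" using component_colorings \<gamma> by blast
    ultimately show ?thesis by blast
  qed
  show ?thesis
  proof
    assume S: "label_component V E k T S"
    then obtain \<gamma> where \<gamma>: "\<gamma> \<in> S" "\<gamma> \<in> ?C"
      by (auto simp: label_component_def induces_connected_def)
    moreover have "S \<subseteq> component V E k T \<gamma>" using sub S \<gamma> by (auto simp: label_component_def)
    ultimately show "\<exists>\<gamma>\<in>?C. S = component V E k T \<gamma>"
      using S ok[of \<gamma>] unfolding label_component_def by blast
  next
    assume "\<exists>\<gamma>\<in>?C. S = component V E k T \<gamma>"
    then obtain \<gamma> where \<gamma>: "\<gamma> \<in> ?C" "S = component V E k T \<gamma>" by blast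
    then show "label_component V E k T S"
      using ok[OF \<gamma>(1)] sub component_self[of \<gamma> V E k T] unfolding label_component_def by blast
  qed
qed

lemma csg_nodes_eq: "csg_nodes V E k T = component V E k T ` colorings V E k"
  unfolding csg_nodes_def label_component_iff by blast

text \<open>The choice made in \<open>csg_label\<close> is harmless, as all elements of a component
  agree on \<open>T\<close>.\<close>

lemma csg_label_component: "csg_label T (component V E k T \<gamma>) = restrict \<gamma> T"
proof -
  have "(SOME \<delta>. \<delta> \<in> component V E k T \<gamma>) \<in> component V E k T \<gamma>"
    using someI[of "\<lambda>\<delta>. \<delta> \<in> component V E k T \<gamma>", OF component_self] .
  then show ?thesis
    unfolding csg_label_def by (rule component_label)
qed

lemma csg_edge_iff:
  "{S, S'} \<in> csg_edges V E k T \<longleftrightarrow> S \<noteq> S' \<and> (\<exists>v \<gamma> \<delta>. recolor V E k v \<gamma> \<delta> \<and>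
     S = component V E k T \<gamma> \<and> S' = component V E k T \<delta>)" (is "?L \<longleftrightarrow> ?R")
proof
  have *: "\<exists>v \<gamma> \<delta>. recolor V E k v \<gamma> \<delta> \<and> P = component V E k T \<gamma> \<and> Q = component V E k T \<delta>"
    if PQ: "P \<in> csg_nodes V E k T" "Q \<in> csg_nodes V E k T" "\<gamma> \<in> P" "\<delta> \<in> Q" "col_adj V \<gamma> \<delta>" for P Q \<gamma> \<delta>
  proof -
    have "P = component V E k T \<gamma>" "Q = component V E k T \<delta>" "\<gamma> \<in> colorings V E k" "\<delta> \<in> colorings V E k"
      using PQ by (auto simp: csg_nodes_eq component_eq dest: component_colorings)
    then show ?thesis using PQ(5) col_adj_iff_recolor by metis
  qed
  assume ?L
  then obtain P Q \<gamma> \<delta> where PQ: "{S, S'} = {P, Q}" "P \<in> csg_nodes V E k T" "Q \<in> csg_nodes V E k T"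
      "P \<noteq> Q" "\<gamma> \<in> P" "\<delta> \<in> Q" "col_adj V \<gamma> \<delta>"
    unfolding csg_edges_def by blast
  obtain v \<alpha> \<beta> where r: "recolor V E k v \<alpha> \<beta>" "P = component V E k T \<alpha>" "Q = component V E k T \<beta>"
    using *[OF PQ(2,3,5-7)] by blast
  from PQ(1) consider "S = P" "S' = Q" | "S = Q" "S' = P" by (auto simp: doubleton_eq_iff)
  then show ?R
  proof cases
    case 1
    then show ?thesis using PQ(4) r by blast
  next
    case 2
    then show ?thesis using PQ(4) recolor_sym[OF r(1)] r(2,3) by blast
  qed
next
  assume ?R
  then obtain v \<gamma> \<delta> where "S \<noteq> S'" and r: "recolor V E k v \<gamma> \<delta>"
    and S: "S = component V E k T \<gamma>" "S' = component V E k T \<delta>" by blast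
  have C: "\<gamma> \<in> colorings V E k" "\<delta> \<in> colorings V E k" using r by (auto simp: recolor_def)
  have "S \<in> csg_nodes V E k T" "S' \<in> csg_nodes V E k T" using C S by (auto simp: csg_nodes_eq)
  moreover have "\<gamma> \<in> S" "\<delta> \<in> S'" unfolding S by (rule component_self)+
  moreover have "col_adj V \<gamma> \<delta>" using r col_adj_iff_recolor[OF C] by blast
  ultimately show ?L
    unfolding csg_edges_def using \<open>S \<noteq> S'\<close> by blast
qed

section \<open>The colour-complete case\<close>

text \<open>\<open>colorings\<close> constrains every edge of \<open>E\<close>, even one that has
  both ends outside the vertex set, where colourings take the same value \<open>undefined\<close>.
  Colourings of an induced subgraph therefore use the edge set
  \<open>E \<inter> Pow W\<close>.\<close>

lemma colorings_extend:
  assumes "\<alpha> \<in> colorings W (E \<inter> Pow W) k" "v \<notin> W" "c \<in> {1..k}" "c \<notin> \<alpha> ` nbrs E W v" "{v} \<notin> E"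
  shows "\<alpha>(v := c) \<in> colorings (insert v W) (E \<inter> Pow (insert v W)) k"
proof -
  have "(\<alpha>(v := c)) x \<noteq> (\<alpha>(v := c)) y" if e: "{x, y} \<in> E" "x \<in> insert v W" "y \<in> insert v W" for x y
  proof -
    consider "x = v" "y = v" | "x = v" "y \<in> nbrs E W v" | "y = v" "x \<in> nbrs E W v" | "x \<in> W" "y \<in> W"
      using e by (auto simp: nbrs_def insert_commute)
    then show ?thesis
    proof cases
      case 1
      then show ?thesis using e(1) assms(5) by simp
    next
      case 2
      then have "y \<noteq> v" using assms(2) by (auto simp: nbrs_def)
      then show ?thesis using 2 assms(4) by auto
    next
      case 3
      then have "x \<noteq> v" using assms(2) by (auto simp: nbrs_def)
      then show ?thesis using 3 assms(4) by auto
    next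
      case 4
      then show ?thesis using assms(1,2) e(1) by (auto simp: colorings_def)
    qed
  qed
  moreover have "\<alpha>(v := c) \<in> insert v W \<rightarrow>\<^sub>E {1..k}"
    using assms(1,3) by (auto simp: colorings_def PiE_def Pi_def extensional_def)
  ultimately show ?thesis by (auto simp: colorings_def)
qed

lemma colorings_restrict:
  "\<alpha> \<in> colorings (insert v W) (E \<inter> Pow (insert v W)) k \<Longrightarrow> restrict \<alpha> W \<in> colorings W (E \<inter> Pow W) k"
  by (auto simp: colorings_def)

lemma free_color:
  assumes "finite Y" "card Y < k"
  obtains c where "c \<in> {1..k}" "c \<notin> Y"
proof -
  have "\<not> {1..k} \<subseteq> Y" using card_mono[OF assms(1), of "{1..k}"] assms(2) by auto
  then show ?thesis using that by blast
qed

text \<open>The colours seen on \<open>N\<close> before and after the step are the old ones and at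
  most one new colour, \<open>\<beta> u\<close>; these are fewer than \<open>k\<close>.\<close>

lemma free_color_recolor:
  assumes r: "recolor W F k u \<alpha> \<beta>" and N: "finite N" "card N + 1 < k"
  obtains c where "c \<in> {1..k}" "c \<notin> \<alpha> ` N" "c \<notin> \<beta> ` N"
proof -
  let ?Y = "insert (\<beta> u) (\<alpha> ` N)"
  have "card ?Y \<le> card N + 1"
    using N(1) card_image_le[of N \<alpha>] card_insert_le_m1[of "Suc (card N)" "\<alpha> ` N" "\<beta> u"] by simp
  then obtain c where c: "c \<in> {1..k}" "c \<notin> ?Y"
    using free_color[of ?Y k] N by auto
  moreover have "\<beta> ` N \<subseteq> ?Y" using recolor_other[OF r] by (auto simp: image_iff) metis
  ultimately show ?thesis using that by blast
qed

text \<open>A simplicial vertex of degree at most \<open>k - 2\<close> always has a spare colour, so it can step aside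
  before any of its neighbours is recoloured.\<close>

lemma label_rel_lift:
  assumes path: "(\<alpha>, \<beta>) \<in> (label_rel W (E \<inter> Pow W) k T)\<^sup>*"
    and v: "v \<notin> W" "T \<subseteq> W" and loopless: "{v} \<notin> E"
    and N: "finite (nbrs E W v)" "card (nbrs E W v) + 1 < k"
    and \<gamma>: "\<gamma> \<in> colorings (insert v W) (E \<inter> Pow (insert v W)) k" "restrict \<gamma> W = \<alpha>"
  shows "\<exists>\<delta>. (\<gamma>, \<delta>) \<in> (label_rel (insert v W) (E \<inter> Pow (insert v W)) k T)\<^sup>* \<and> restrict \<delta> W = \<beta>"
  using path
proof (induction rule: rtrancl_induct)
  case base
  then show ?case using \<gamma> by blast
next
  case (step \<beta> \<beta>')
  let ?F = "E \<inter> Pow (insert v W)"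
  let ?R = "label_rel (insert v W) ?F k T"
  obtain \<delta> where \<delta>: "(\<gamma>, \<delta>) \<in> ?R\<^sup>*" "restrict \<delta> W = \<beta>" using step.IH by blast
  obtain u where u: "u \<notin> T" "recolor W (E \<inter> Pow W) k u \<beta> \<beta>'"
    using step.hyps(2) by (auto simp: label_rel_def)
  obtain c where c: "c \<in> {1..k}" "c \<notin> \<beta> ` nbrs E W v" "c \<notin> \<beta>' ` nbrs E W v"
    using free_color_recolor[OF u(2) N] by metis
  have \<delta>C: "\<delta> \<in> colorings (insert v W) ?F k" using label_rel_rtrancl(2)[OF \<delta>(1)] \<gamma>(1) .
  have C: "\<beta>(v := c) \<in> colorings (insert v W) ?F k" "\<beta>'(v := c) \<in> colorings (insert v W) ?F k"
    using colorings_extend[OF _ v(1) c(1) _ loopless] c(2,3) u(2) by (simp_all add: recolor_def)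
  have \<delta>\<beta>: "\<delta> x = \<beta> x" if "x \<noteq> v" for x
    using \<delta>(2) that colorings_outside[OF \<delta>C, of x] by (auto simp: restrict_def)
  \<comment> \<open>First \<open>v\<close> moves to the spare colour \<open>c\<close>, unless it
    already has it; then \<open>u\<close> is recoloured as in the smaller graph.\<close>
  have "\<delta> = \<beta>(v := c) \<or> recolor (insert v W) ?F k v \<delta> (\<beta>(v := c))"
    using \<delta>C C \<delta>\<beta> by (auto simp: recolor_def)
  then have "(\<delta>, \<beta>(v := c)) \<in> ?R\<^sup>*" using v by (auto simp: label_rel_def)
  moreover have "recolor (insert v W) ?F k u (\<beta>(v := c)) (\<beta>'(v := c))"
    using u(2) v C by (auto simp: recolor_def)
  then have "(\<beta>(v := c), \<beta>'(v := c)) \<in> ?R" using u(1) by (auto simp: label_rel_def)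
  ultimately have "(\<gamma>, \<beta>'(v := c)) \<in> ?R\<^sup>*" using \<delta>(1) by (meson rtrancl.rtrancl_into_rtrancl rtrancl_trans)
  moreover have "restrict (\<beta>'(v := c)) W = \<beta>'"
    using v(1) u(2) colorings_outside[of \<beta>'] by (auto simp: recolor_def restrict_def)
  ultimately show ?case by blast
qed

text \<open>An attached vertex forms a clique with its earlier neighbours, so there are at most
  \<open>l\<close> of these and it has a spare colour during any step. The first part will show that
  labels determine nodes, the second will supply nodes and edges.\<close>

lemma attach_colorings_connected:
  assumes "attach l E B W" "finite W" "\<forall>K. is_clique W E K \<longrightarrow> card K \<le> l + 1" "l + 2 \<le> k"
    and loopless: "\<And>v. {v} \<notin> E"
  shows "(\<forall>\<alpha>\<in>colorings W (E \<inter> Pow W) k. \<forall>\<beta>\<in>colorings W (E \<inter> Pow W) k.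
      restrict \<alpha> B = restrict \<beta> B \<longrightarrow> (\<alpha>, \<beta>) \<in> (label_rel W (E \<inter> Pow W) k B)\<^sup>*) \<and>
    (\<forall>t \<alpha> \<beta>. recolor B (E \<inter> Pow B) k t \<alpha> \<beta> \<longrightarrow>
      (\<exists>\<gamma> \<delta>. recolor W (E \<inter> Pow W) k t \<gamma> \<delta> \<and> restrict \<gamma> B = \<alpha> \<and> restrict \<delta> B = \<beta>))"
  using assms(1-4)
proof (induction rule: attach.induct)
  case base
  have *: "restrict \<alpha> B = \<alpha>" if "\<alpha> \<in> colorings B (E \<inter> Pow B) k" for \<alpha>
    using that unfolding colorings_def by (blast intro: PiE_restrict)
  have "\<exists>\<gamma> \<delta>. recolor B (E \<inter> Pow B) k t \<gamma> \<delta> \<and> restrict \<gamma> B = \<alpha> \<and> restrict \<delta> B = \<beta>"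
    if "recolor B (E \<inter> Pow B) k t \<alpha> \<beta>" for t \<alpha> \<beta>
    using that *[of \<alpha>] *[of \<beta>] by (intro exI[of _ \<alpha>] exI[of _ \<beta>]) (simp add: recolor_def)
  moreover have "\<alpha> = \<beta>" if "\<alpha> \<in> colorings B (E \<inter> Pow B) k" "\<beta> \<in> colorings B (E \<inter> Pow B) k"
    "restrict \<alpha> B = restrict \<beta> B" for \<alpha> \<beta>
    using that *[of \<alpha>] *[of \<beta>] by simp
  ultimately show ?case by blast
next
  case (step W v)
  let ?N = "nbrs E W v" and ?F = "E \<inter> Pow (insert v W)"
  let ?C = "colorings (insert v W) ?F k"
  have finW: "finite W" using step.prems(1) by simp
  have finN: "finite ?N" using finW by (auto simp: nbrs_def)
  have B: "B \<subseteq> W" using attach_subset[OF step.hyps(1)] .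
  have "is_clique (insert v W) E (insert v ?N)"
    using step.hyps(3) by (auto simp: is_clique_def nbrs_def insert_commute)
  then have "card (insert v ?N) \<le> l + 1" using step.prems(2) by blast
  moreover have "v \<notin> ?N" using step.hyps(2) by (auto simp: nbrs_def)
  ultimately have N: "card ?N + 1 < k" using finN step.prems(3) by simp
  have cl: "\<forall>K. is_clique W E K \<longrightarrow> card K \<le> l + 1"
    using step.prems(2) unfolding is_clique_def by blast
  note IH = step.IH[OF finW cl step.prems(3)]
  have "(\<alpha>, \<beta>) \<in> (label_rel (insert v W) ?F k B)\<^sup>*"
    if \<alpha>: "\<alpha> \<in> ?C" and \<beta>: "\<beta> \<in> ?C" and eq: "restrict \<alpha> B = restrict \<beta> B" for \<alpha> \<beta>
  proof -
    have "restrict (restrict \<alpha> W) B = restrict (restrict \<beta> W) B"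
      using eq B by (metis Int_absorb1 restrict_restrict)
    then have "(restrict \<alpha> W, restrict \<beta> W) \<in> (label_rel W (E \<inter> Pow W) k B)\<^sup>*"
      using conjunct1[OF IH, rule_format, OF colorings_restrict[OF \<alpha>] colorings_restrict[OF \<beta>]] by blast
    from label_rel_lift[OF this step.hyps(2) B loopless finN N \<alpha> refl]
    obtain \<delta> where \<delta>: "(\<alpha>, \<delta>) \<in> (label_rel (insert v W) ?F k B)\<^sup>*" "restrict \<delta> W = restrict \<beta> W"
      by blast
    have \<delta>C: "\<delta> \<in> ?C" using label_rel_rtrancl(2)[OF \<delta>(1)] \<alpha> .
    have "\<delta> x = \<beta> x" if "x \<noteq> v" for x
    proof (cases "x \<in> W")
      case True
      then show ?thesis using fun_cong[OF \<delta>(2), of x] by simp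
    next
      case False
      then show ?thesis using colorings_outside[OF \<delta>C, of x] colorings_outside[OF \<beta>, of x] that by simp
    qed
    \<comment> \<open>The lifted walk can miss its target only at \<open>v\<close>, which one last
      step repairs.\<close>
    then have "\<delta> = \<beta> \<or> recolor (insert v W) ?F k v \<delta> \<beta>"
      using \<delta>C \<beta> unfolding recolor_def by (metis ext insertI1)
    then have "(\<delta>, \<beta>) \<in> (label_rel (insert v W) ?F k B)\<^sup>*"
      using step.hyps(2) B by (auto simp: label_rel_def)
    then show ?thesis using \<delta>(1) by simp
  qed
  moreover have "\<exists>\<gamma> \<delta>. recolor (insert v W) ?F k t \<gamma> \<delta> \<and> restrict \<gamma> B = \<alpha> \<and> restrict \<delta> B = \<beta>"
    if ab: "recolor B (E \<inter> Pow B) k t \<alpha> \<beta>" for t \<alpha> \<beta>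
  proof -
    obtain \<gamma> \<delta> where r: "recolor W (E \<inter> Pow W) k t \<gamma> \<delta>" "restrict \<gamma> B = \<alpha>" "restrict \<delta> B = \<beta>"
      using conjunct2[OF IH, rule_format, OF ab] by blast
    obtain c where c: "c \<in> {1..k}" "c \<notin> \<gamma> ` ?N" "c \<notin> \<delta> ` ?N"
      using free_color_recolor[OF r(1) finN N] by metis
    have "\<gamma>(v := c) \<in> ?C" "\<delta>(v := c) \<in> ?C"
      using colorings_extend[OF _ step.hyps(2) c(1) _ loopless] c(2,3) r(1) by (simp_all add: recolor_def)
    then have "recolor (insert v W) ?F k t (\<gamma>(v := c)) (\<delta>(v := c))"
      using r(1) step.hyps(2) by (auto simp: recolor_def)
    moreover have "restrict (\<gamma>(v := c)) B = \<alpha>" "restrict (\<delta>(v := c)) B = \<beta>"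
      using r(2,3) B step.hyps(2) by (metis restrict_fupd subsetD)+
    ultimately show ?thesis by blast
  qed
  ultimately show ?case by blast
qed

lemma clique_colorings:
  assumes "is_clique V E T" and loopless: "\<And>v. {v} \<notin> E"
  shows "colorings T (E \<inter> Pow T) k = complete_colorings T k"
proof -
  have "{u, v} \<in> E \<inter> Pow T \<longleftrightarrow> u \<in> T \<and> v \<in> T \<and> u \<noteq> v" for u v
    using assms by (auto simp: is_clique_def)
  then show ?thesis unfolding colorings_def complete_colorings_def inj_on_def by fastforce
qed

lemma color_complete_csg:
  assumes G: "simple_graph V E" and att: "attach l E T V" and T: "is_clique V E T" "0 < card T"
    and cl: "\<forall>K. is_clique V E K \<longrightarrow> card K \<le> l + 1" and k: "l + 2 \<le> k"
  shows "color_complete (card T) k (csg_nodes V E k T) (csg_edges V E k T) (csg_label T)"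
proof -
  have finV: "finite V" and loopless: "\<And>v. {v} \<notin> E" and EV: "E \<inter> Pow V = E"
    using G by (auto simp: simple_graph_def)
  let ?C = "colorings V E k" and ?c = "component V E k T"
  have finT: "finite T" using T(2) card_ge_0_finite by blast
  have TV: "T \<subseteq> V" using T(1) by (auto simp: is_clique_def)
  have CT: "colorings T (E \<inter> Pow T) k = complete_colorings T k"
    using clique_colorings[OF T(1) loopless] .
  have conn: "?c \<alpha> = ?c \<beta>" if "\<alpha> \<in> ?C" "\<beta> \<in> ?C" "restrict \<alpha> T = restrict \<beta> T" for \<alpha> \<beta>
    using attach_colorings_connected[OF att finV cl k loopless] that component_eqI unfolding EV by blast
  have lift: "\<exists>\<gamma> \<delta>. recolor V E k t \<gamma> \<delta> \<and> restrict \<gamma> T = \<alpha> \<and> restrict \<delta> T = \<beta>"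
    if "recolor T (E \<inter> Pow T) k t \<alpha> \<beta>" for t \<alpha> \<beta>
    using attach_colorings_connected[OF att finV cl k loopless] that unfolding EV by blast
  have labC: "restrict \<gamma> T \<in> complete_colorings T k" if "\<gamma> \<in> ?C" for \<gamma>
    unfolding CT[symmetric] using that TV by (auto simp: colorings_def)
  have "\<exists>!x. x \<in> csg_nodes V E k T \<and> csg_label T x = c" if c: "c \<in> complete_colorings T k" for c
  proof -
    \<comment> \<open>Only recolourings can be lifted, so \<open>c\<close> is realised as the start
      of one: some \<open>t\<close> in \<open>T\<close> receives a colour \<open>b\<close> that is
      missing on \<open>T\<close>, which exists because \<open>T\<close> has fewer than
      \<open>k\<close> vertices.\<close>
    obtain t where t: "t \<in> T" using T(2) by fastforce
    have "card (c ` T) \<le> card T" using card_image_le finT by blast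
    then obtain b where b: "b \<in> {1..k}" "b \<notin> c ` T"
      using free_color[of "c ` T" k] cl[rule_format, OF T(1)] k finT by auto
    have "c(t := b) \<in> complete_colorings T k"
      using c b t by (auto simp: complete_colorings_def PiE_def Pi_def extensional_def inj_on_def)
    then have "recolor T (E \<inter> Pow T) k t c (c(t := b))"
      using c t b by (auto simp: recolor_def CT)
    then obtain \<gamma> \<delta> where r: "recolor V E k t \<gamma> \<delta>" "restrict \<gamma> T = c" using lift by blast
    then have "\<gamma> \<in> ?C" by (auto simp: recolor_def)
    show ?thesis
    proof (rule ex1I[of _ "?c \<gamma>"])
      show "?c \<gamma> \<in> csg_nodes V E k T \<and> csg_label T (?c \<gamma>) = c"
        using \<open>\<gamma> \<in> ?C\<close> r(2) by (simp add: csg_nodes_eq csg_label_component)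
    next
      fix x assume x: "x \<in> csg_nodes V E k T \<and> csg_label T x = c"
      then obtain \<beta> where "\<beta> \<in> ?C" "x = ?c \<beta>" by (auto simp: csg_nodes_eq)
      then show "x = ?c \<gamma>" using x conn[of \<beta> \<gamma>] \<open>\<gamma> \<in> ?C\<close> r(2) by (simp add: csg_label_component)
    qed
  qed
  moreover have "{x, y} \<in> csg_edges V E k T \<longleftrightarrow> card {t \<in> T. csg_label T x t \<noteq> csg_label T y t} = 1"
    if xy: "x \<in> csg_nodes V E k T" "y \<in> csg_nodes V E k T" for x y
  proof
    assume "{x, y} \<in> csg_edges V E k T"
    then obtain v \<gamma> \<delta> where r: "x \<noteq> y" "recolor V E k v \<gamma> \<delta>" "x = ?c \<gamma>" "y = ?c \<delta>"
      unfolding csg_edge_iff by blast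
    then have "v \<in> T" using component_recolor by metis
    then have "{t \<in> T. csg_label T x t \<noteq> csg_label T y t} = {v}"
      using r by (auto simp: csg_label_component recolor_def)
    then show "card {t \<in> T. csg_label T x t \<noteq> csg_label T y t} = 1" by simp
  next
    obtain \<alpha> \<beta> where ab: "\<alpha> \<in> ?C" "\<beta> \<in> ?C" "x = ?c \<alpha>" "y = ?c \<beta>" using xy by (auto simp: csg_nodes_eq)
    assume card: "card {t \<in> T. csg_label T x t \<noteq> csg_label T y t} = 1"
    have "col_adj T (restrict \<alpha> T) (restrict \<beta> T)"
      using card unfolding ab csg_label_component col_adj_def .
    moreover have C: "restrict \<alpha> T \<in> colorings T (E \<inter> Pow T) k" "restrict \<beta> T \<in> colorings T (E \<inter> Pow T) k"
      using labC ab(1,2) CT by auto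
    ultimately obtain t where "recolor T (E \<inter> Pow T) k t (restrict \<alpha> T) (restrict \<beta> T)"
      using col_adj_iff_recolor[OF C] by blast
    then obtain \<gamma> \<delta> where r: "recolor V E k t \<gamma> \<delta>" "restrict \<gamma> T = restrict \<alpha> T" "restrict \<delta> T = restrict \<beta> T"
      using lift by blast
    moreover have "x = ?c \<gamma>" "y = ?c \<delta>"
      using conn[of \<alpha> \<gamma>] conn[of \<beta> \<delta>] ab r by (simp_all add: recolor_def)
    moreover have "x \<noteq> y" using card by auto
    ultimately show "{x, y} \<in> csg_edges V E k T" unfolding csg_edge_iff by blast
  qed
  moreover have "\<forall>x\<in>csg_nodes V E k T. csg_label T x \<in> complete_colorings T k"
    using labC by (auto simp: csg_nodes_eq csg_label_component)
  ultimately show ?thesis unfolding color_complete_def using finT by blast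
qed

section \<open>Cancellation in walks of the colour graph\<close>

lemma clique_inj_on: "is_clique V E Q \<Longrightarrow> \<gamma> \<in> colorings V E k \<Longrightarrow> inj_on \<gamma> Q"
  unfolding is_clique_def inj_on_def using colorings_edge by metis

text \<open>The other vertices of \<open>Q\<close> had colours different from
  \<open>\<gamma> v\<close> and keep them, while \<open>v\<close> itself has given that colour
  up.\<close>

lemma recolor_old_color:
  assumes "recolor V E k v \<gamma> \<delta>" "is_clique V E Q" "v \<in> Q"
  shows "\<gamma> v \<notin> \<delta> ` Q"
proof
  assume "\<gamma> v \<in> \<delta> ` Q"
  then obtain f where f: "f \<in> Q" "\<gamma> v = \<delta> f" by blast
  then have "f \<noteq> v" using assms(1) by (auto simp: recolor_def)
  then have "{v, f} \<in> E" "\<delta> f = \<gamma> f" using assms f by (auto simp: is_clique_def recolor_def)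
  then show False using f(2) assms(1) colorings_edge[of \<gamma> V E k v f] by (auto simp: recolor_def)
qed

lemma insert_of_card:
  assumes "finite Q" "P \<subseteq> Q" "card Q = l + 1" "l \<le> card P" "u \<in> Q - P"
  shows "Q = insert u P"
proof -
  have "finite P" using assms finite_subset by blast
  then have "card Q \<le> card (insert u P)" using assms by simp
  then show ?thesis using card_seteq[of Q "insert u P"] assms by blast
qed

text \<open>The alternative behind all chain arguments: a letter that occurs once ends with a
  changed colour by \<open>walk_once\<close>, and two successive occurrences with no vertex of
  \<open>Q\<close> between them are a candidate for cancellation.\<close>

lemma single_or_repeated:
  assumes "Q \<inter> set w \<subseteq> {u}" "u \<in> set w"
  obtains (single) A B where "w = A @ u # B" "u \<notin> set A" "u \<notin> set B"
    | (repeated) A B C where "w = A @ u # B @ u # C" "Q \<inter> set B = {}"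
proof -
  obtain A B where w: "w = A @ u # B" "u \<notin> set A" using assms(2) by (meson split_list_first)
  show ?thesis
  proof (cases "u \<in> set B")
    case True
    then obtain B' C where B: "B = B' @ u # C" "u \<notin> set B'" by (meson split_list_first)
    then have "Q \<inter> set B' = {}" using assms(1) w by auto
    with w B show ?thesis by (intro repeated) auto
  qed (use w single in blast)
qed

text \<open>Under this condition a stretch of a walk keeps its parity when the colour of an
  untouched vertex \<open>v\<close>, not adjacent to any letter of the stretch, is replaced
  throughout.\<close>

definition shift_invariant :: "'a set \<Rightarrow> 'a set set \<Rightarrow> nat \<Rightarrow> (('a \<Rightarrow> nat) \<Rightarrow> ('a \<Rightarrow> nat) \<Rightarrow> bool) \<Rightarrow> bool" where
  "shift_invariant V E k \<phi> \<longleftrightarrow> (\<forall>u v a \<beta> \<beta>'. u \<noteq> v \<longrightarrow> {u, v} \<notin> E \<longrightarrow> recolor V E k u \<beta> \<beta>' \<longrightarrow>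
     recolor V E k u (\<beta>(v := a)) (\<beta>'(v := a)) \<longrightarrow> \<phi> (\<beta>(v := a)) (\<beta>'(v := a)) = \<phi> \<beta> \<beta>')"

text \<open>The Boolean argument \<open>p\<close> is the parity of the number of steps that satisfy \<open>\<phi>\<close>.\<close>

inductive walk for V :: "'a set" and E k \<phi> where
  Nil: "\<gamma> \<in> colorings V E k \<Longrightarrow> walk V E k \<phi> \<gamma> [] False \<gamma>"
| Cons: "recolor V E k v \<gamma> \<delta> \<Longrightarrow> walk V E k \<phi> \<delta> w p \<epsilon> \<Longrightarrow> walk V E k \<phi> \<gamma> (v # w) (\<phi> \<gamma> \<delta> \<noteq> p) \<epsilon>"

section \<open>Elementary operations on walks\<close>

lemma walk_NilE: "walk V E k \<phi> \<gamma> [] p \<delta> \<Longrightarrow> \<delta> = \<gamma> \<and> \<not> p"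
  by (auto elim: walk.cases)

lemma walk_ConsE:
  assumes "walk V E k \<phi> \<gamma> (v # w) p \<epsilon>"
  obtains \<delta> q where "recolor V E k v \<gamma> \<delta>" "walk V E k \<phi> \<delta> w q \<epsilon>" "p = (\<phi> \<gamma> \<delta> \<noteq> q)"
  using assms by (cases rule: walk.cases) auto

lemma walk_colorings:
  "walk V E k \<phi> \<gamma> w p \<delta> \<Longrightarrow> \<gamma> \<in> colorings V E k"
  "walk V E k \<phi> \<gamma> w p \<delta> \<Longrightarrow> \<delta> \<in> colorings V E k"
  by (induction rule: walk.induct) (auto simp: recolor_def)

lemma walk_append:
  "walk V E k \<phi> \<gamma> u p \<delta> \<Longrightarrow> walk V E k \<phi> \<delta> w q \<epsilon> \<Longrightarrow> walk V E k \<phi> \<gamma> (u @ w) (p \<noteq> q) \<epsilon>"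
proof (induction rule: walk.induct)
  case (Nil \<gamma>)
  then show ?case by simp
next
  case (Cons v \<gamma> \<delta> w' p \<epsilon>')
  then have "walk V E k \<phi> \<delta> (w' @ w) (p \<noteq> q) \<epsilon>" by blast
  from walk.Cons[OF Cons.hyps(1) this]
  have "walk V E k \<phi> \<gamma> (v # w' @ w) (\<phi> \<gamma> \<delta> \<noteq> (p \<noteq> q)) \<epsilon>" .
  moreover have "(\<phi> \<gamma> \<delta> \<noteq> (p \<noteq> q)) = ((\<phi> \<gamma> \<delta> \<noteq> p) \<noteq> q)" by blast
  ultimately show ?case by simp
qed

lemma walk_appendE:
  assumes "walk V E k \<phi> \<gamma> (u @ w) r \<epsilon>"
  obtains \<delta> p q where "walk V E k \<phi> \<gamma> u p \<delta>" "walk V E k \<phi> \<delta> w q \<epsilon>" "r = (p \<noteq> q)"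
  using assms
proof (induction u arbitrary: \<gamma> r thesis)
  case Nil
  then show ?case using walk.Nil walk_colorings(1) by (metis append_Nil)
next
  case (Cons v u)
  have "walk V E k \<phi> \<gamma> (v # u @ w) r \<epsilon>" using Cons.prems(2) by simp
  then obtain \<delta> s where s: "recolor V E k v \<gamma> \<delta>" "walk V E k \<phi> \<delta> (u @ w) s \<epsilon>"
      "r = (\<phi> \<gamma> \<delta> \<noteq> s)"
    by (rule walk_ConsE)
  from Cons.IH[OF _ s(2)] obtain \<eta> p q where "walk V E k \<phi> \<delta> u p \<eta>" "walk V E k \<phi> \<eta> w q \<epsilon>" "s = (p \<noteq> q)"
    by blast
  then show ?case using Cons.prems(1)[of "\<phi> \<gamma> \<delta> \<noteq> p" \<eta> q] walk.Cons[OF s(1), of \<phi> u p \<eta>] s(3) by blast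
qed

lemma walk_single: "recolor V E k v \<gamma> \<delta> \<Longrightarrow> walk V E k \<phi> \<gamma> [v] (\<phi> \<gamma> \<delta>) \<delta>"
  using walk.Cons[of V E k v \<gamma> \<delta> \<phi> "[]" False \<delta>] walk.Nil[of \<delta> V E k \<phi>] by (auto simp: recolor_def)

lemma walk_other: "walk V E k \<phi> \<gamma> w p \<delta> \<Longrightarrow> u \<notin> set w \<Longrightarrow> \<delta> u = \<gamma> u"
  by (induction rule: walk.induct) (auto simp: recolor_other)

lemma walk_letter: "walk V E k \<phi> \<gamma> w p \<delta> \<Longrightarrow> u \<in> set w \<Longrightarrow> \<exists>\<beta> \<beta>'. recolor V E k u \<beta> \<beta>'"
  by (induction rule: walk.induct) auto

lemma walk_once:
  assumes "walk V E k \<phi> \<gamma> (A @ u # B) p \<delta>" "u \<notin> set A" "u \<notin> set B"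
  shows "\<gamma> u \<noteq> \<delta> u"
proof -
  from assms(1) obtain \<beta> q q' where "walk V E k \<phi> \<gamma> A q \<beta>" and B: "walk V E k \<phi> \<beta> (u # B) q' \<delta>"
    by (elim walk_appendE)
  then have "\<beta> u = \<gamma> u" using assms(2) walk_other by metis
  moreover from B obtain \<beta>' r where "recolor V E k u \<beta> \<beta>'" "walk V E k \<phi> \<beta>' B r \<delta>"
    by (elim walk_ConsE)
  ultimately show ?thesis using assms(3) walk_other unfolding recolor_def by metis
qed

lemma walk_component:
  "walk V E k \<phi> \<gamma> w p \<delta> \<Longrightarrow> T \<inter> set w = {} \<Longrightarrow> component V E k T \<gamma> = component V E k T \<delta>"
proof (induction rule: walk.induct)
  case (Cons v \<gamma> \<delta> w p \<epsilon>)
  then show ?case using component_recolor[of V E k v \<gamma> \<delta> T] by simp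
qed simp

lemma component_walk:
  assumes "(\<gamma>, \<delta>) \<in> (label_rel V E k T)\<^sup>*" "\<gamma> \<in> colorings V E k"
    and \<phi>: "\<forall>v \<beta> \<beta>'. v \<notin> T \<longrightarrow> recolor V E k v \<beta> \<beta>' \<longrightarrow> \<not> \<phi> \<beta> \<beta>'"
  shows "\<exists>w. walk V E k \<phi> \<gamma> w False \<delta> \<and> T \<inter> set w = {}"
  using assms(1)
proof (induction rule: rtrancl_induct)
  case base
  then show ?case using walk.Nil[OF assms(2)] by (intro exI[of _ "[]"]) simp
next
  case (step \<beta> \<beta>')
  then obtain w v where w: "walk V E k \<phi> \<gamma> w False \<beta>" "T \<inter> set w = {}" "v \<notin> T" "recolor V E k v \<beta> \<beta>'"
    by (auto simp: label_rel_def)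
  then have "walk V E k \<phi> \<gamma> (w @ [v]) False \<beta>'"
    using walk_append[OF w(1) walk_single[OF w(4)]] \<phi> by simp
  with w show ?case by (intro exI[of _ "w @ [v]"]) simp
qed

text \<open>As \<open>w\<close> avoids \<open>v\<close> and its neighbours, a colour of
  \<open>v\<close> that is legal at the start stays legal throughout.\<close>

lemma walk_shift:
  assumes "walk V E k \<phi> \<gamma> w p \<delta>" "\<forall>u\<in>set w. u \<noteq> v \<and> {u, v} \<notin> E" "\<gamma>(v := a) \<in> colorings V E k"
    and \<phi>: "shift_invariant V E k \<phi>"
  shows "walk V E k \<phi> (\<gamma>(v := a)) w p (\<delta>(v := a))"
  using assms(1-3)
proof (induction rule: walk.induct)
  case (Nil \<gamma>)
  then show ?case by (auto intro: walk.Nil)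
next
  case (Cons u \<gamma> \<delta> w p \<epsilon>)
  have u: "u \<noteq> v" "{u, v} \<notin> E" using Cons.prems by auto
  have r: "recolor V E k u \<gamma> \<delta>" by fact
  have "(\<delta>(v := a)) x \<noteq> (\<delta>(v := a)) y" if e: "{x, y} \<in> E" for x y
  proof (cases "x = v \<or> y = v")
    case True
    then have "x \<noteq> u" "y \<noteq> u" using u e by (auto simp: insert_commute)
    then have "(\<delta>(v := a)) x = (\<gamma>(v := a)) x" "(\<delta>(v := a)) y = (\<gamma>(v := a)) y"
      using recolor_other[OF r] by auto
    then show ?thesis using colorings_edge[OF Cons.prems(2) e] by simp
  next
    case False
    then show ?thesis using colorings_edge[OF _ e] r by (auto simp: recolor_def)
  qed
  moreover have "\<delta>(v := a) \<in> V \<rightarrow>\<^sub>E {1..k}"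
  proof (rule PiE_I)
    fix x assume "x \<in> V"
    then show "(\<delta>(v := a)) x \<in> {1..k}"
      using colorings_range[OF Cons.prems(2), of v] colorings_range[of \<delta>] r
      by (cases "x = v") (auto simp: recolor_def)
  next
    fix x assume "x \<notin> V"
    then show "(\<delta>(v := a)) x = undefined"
      using colorings_outside[OF Cons.prems(2), of v] colorings_outside[of \<delta>] r
      by (cases "x = v") (auto simp: recolor_def)
  qed
  ultimately have C: "\<delta>(v := a) \<in> colorings V E k" by (auto simp: colorings_def)
  moreover have "(\<gamma>(v := a)) u \<noteq> (\<delta>(v := a)) u" "\<forall>x. x \<noteq> u \<longrightarrow> (\<gamma>(v := a)) x = (\<delta>(v := a)) x" "u \<in> V"
    using r u by (auto simp: recolor_def)
  ultimately have r': "recolor V E k u (\<gamma>(v := a)) (\<delta>(v := a))"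
    using Cons.prems(2) unfolding recolor_def by blast
  have "\<forall>u\<in>set w. u \<noteq> v \<and> {u, v} \<notin> E" using Cons.prems(1) by simp
  note walk' = walk.Cons[OF r' Cons.IH[OF this C]]
  have "\<phi> (\<gamma>(v := a)) (\<delta>(v := a)) = \<phi> \<gamma> \<delta>"
    using \<phi> u r r' unfolding shift_invariant_def by blast
  then show ?case using walk' by (simp only:)
qed

locale clique_connected =
  fixes V :: "'a set" and E :: "'a set set" and k l :: nat
  assumes simple: "simple_graph V E" and k: "k = l + 2" "1 \<le> l"
    and extend: "is_clique V E X \<Longrightarrow> card X \<le> l + 1 \<Longrightarrow> \<exists>Q. is_clique V E Q \<and> card Q = l + 1 \<and> X \<subseteq> Q"
    and chain: "is_clique V E P \<Longrightarrow> card P = l + 1 \<Longrightarrow> X \<subseteq> P \<Longrightarrow>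
      is_clique V E Q \<Longrightarrow> card Q = l + 1 \<Longrightarrow> X \<subseteq> Q \<Longrightarrow> (P, Q) \<in> (clique_steps l V E X)\<^sup>*"
begin

lemma finV: "finite V" using simple by (simp add: simple_graph_def)

lemma finite_clique: "is_clique V E Q \<Longrightarrow> finite Q"
  using finV finite_subset by (auto simp: is_clique_def)

lemma edgeD: "{u, v} \<in> E \<Longrightarrow> u \<noteq> v \<and> u \<in> V \<and> v \<in> V"
  using simple unfolding simple_graph_def by (metis doubleton_eq_iff insert_absorb2)

lemma unique_color:
  assumes "Y \<subseteq> {1..k}" "l + 1 \<le> card Y" "c \<in> {1..k} - Y" "d \<in> {1..k} - Y"
  shows "c = d"
proof -
  have "card ({1..k} - Y) \<le> 1"
    using assms(1,2) k card_Diff_subset[of Y "{1..k}"] finite_subset[OF assms(1)] by simp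
  moreover have "finite ({1..k} - Y)" by simp
  ultimately show ?thesis using assms(3,4) by (metis One_nat_def card_le_Suc0_iff_eq)
qed

lemma clique_image:
  assumes "is_clique V E Q" "\<gamma> \<in> colorings V E k"
  shows "\<gamma> ` Q \<subseteq> {1..k}" "card (\<gamma> ` Q) = card Q"
  using assms colorings_range card_image[OF clique_inj_on[OF assms]] by (fastforce simp: is_clique_def)+

text \<open>Such a clique shows all \<open>k\<close> colours before and after any step, but a step
  at one of its vertices would lose the old colour of that vertex.\<close>

lemma frozen:
  assumes K: "is_clique V E K" "card K = l + 2" and r: "recolor V E k v \<gamma> \<delta>"
  shows "v \<notin> K"
proof
  assume v: "v \<in> K"
  have "\<delta> \<in> colorings V E k" using r by (simp add: recolor_def)
  then have "\<delta> ` K = {1..k}"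
    using clique_image[OF K(1), of \<delta>] K(2) k by (intro card_subset_eq) auto
  moreover have "\<gamma> v \<in> {1..k}" using r by (intro colorings_range[of \<gamma> V E]) (auto simp: recolor_def)
  ultimately show False using recolor_old_color[OF r K(1) v] by simp
qed

text \<open>\<open>Q\<close> keeps its \<open>l + 1\<close> colours during \<open>B\<close>, and
  they leave a single other colour: the one that \<open>v\<close> gave up in its first move and must
  take in its second.\<close>

lemma return_color:
  assumes r: "recolor V E k v \<gamma>1 \<gamma>2" "walk V E k \<phi> \<gamma>2 B p \<gamma>3" "recolor V E k v \<gamma>3 \<gamma>4"
    and Q: "is_clique V E Q" "card Q = l + 1" "v \<in> Q" "Q \<inter> set B = {}"
  shows "\<gamma>4 v = \<gamma>1 v"
proof -
  have C: "\<gamma>1 \<in> colorings V E k" "\<gamma>2 \<in> colorings V E k" "\<gamma>4 \<in> colorings V E k" "v \<in> V"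
    using r by (auto simp: recolor_def)
  have "\<gamma>3 ` Q = \<gamma>2 ` Q" using walk_other[OF r(2)] Q(4) by (intro image_cong) auto
  then have "\<gamma>4 v \<in> {1..k} - \<gamma>2 ` Q"
    using recolor_old_color[OF recolor_sym[OF r(3)] Q(1,3)] colorings_range[OF C(3,4)] by simp
  moreover have "\<gamma>1 v \<in> {1..k} - \<gamma>2 ` Q"
    using recolor_old_color[OF r(1) Q(1,3)] colorings_range[OF C(1,4)] by simp
  moreover have "l + 1 \<le> card (\<gamma>2 ` Q)" using clique_image(2)[OF Q(1) C(2)] Q(2) by simp
  ultimately show ?thesis using unique_color[OF clique_image(1)[OF Q(1) C(2)]] by blast
qed

text \<open>The vertex \<open>u\<close> sees all of \<open>F\<close>, which keeps at least
  \<open>l\<close> colours during \<open>B\<close>, and it sees the further colour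
  \<open>\<gamma>1 v\<close> on \<open>v\<close> just before and just after. Since \<open>u\<close>
  does not move in the two steps at \<open>v\<close>, only one colour remains for it at either end
  of \<open>B\<close>.\<close>

lemma same_color:
  assumes r: "recolor V E k v \<gamma>1 \<gamma>2" "walk V E k \<phi> \<gamma>2 B p \<gamma>3" "recolor V E k v \<gamma>3 \<gamma>4" "\<gamma>4 v = \<gamma>1 v"
    and F: "is_clique V E F" "l \<le> card F" "v \<in> F" "F \<inter> set B = {}"
    and u: "u \<notin> F" "is_clique V E (insert u F)"
  shows "\<gamma>2 u = \<gamma>3 u"
proof -
  have C: "\<gamma>1 \<in> colorings V E k" "\<gamma>2 \<in> colorings V E k" "\<gamma>3 \<in> colorings V E k"
     "\<gamma>4 \<in> colorings V E k" "v \<in> V" "u \<in> V"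
    using r u by (auto simp: recolor_def is_clique_def)
  have uF: "{u, f} \<in> E" if "f \<in> F" for f using u that by (auto simp: is_clique_def)
  have uv: "u \<noteq> v" using u F by blast
  let ?Y = "insert (\<gamma>1 v) (\<gamma>2 ` F)"
  have "\<gamma>1 v \<notin> \<gamma>2 ` F" using recolor_old_color[OF r(1) F(1,3)] .
  then have "l + 1 \<le> card ?Y"
    using clique_image(2)[OF F(1) C(2)] F(2) finite_clique[OF F(1)] by simp
  moreover have "?Y \<subseteq> {1..k}"
    using clique_image(1)[OF F(1) C(2)] colorings_range[OF C(1,5)] by simp
  moreover have "\<gamma>2 u \<notin> ?Y"
    using colorings_edge[OF C(2) uF] colorings_edge[OF C(1) uF[OF F(3)]] recolor_other[OF r(1) uv] by auto
  moreover have "\<gamma>3 u \<notin> ?Y"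
  proof -
    have "\<gamma>3 u \<noteq> \<gamma>2 f" if "f \<in> F" for f
    proof -
      have "f \<notin> set B" using that F(4) by blast
      then show ?thesis using colorings_edge[OF C(3) uF[OF that]] walk_other[OF r(2)] by simp
    qed
    moreover have "\<gamma>3 u \<noteq> \<gamma>1 v"
      using colorings_edge[OF C(4) uF[OF F(3)]] recolor_other[OF r(3) uv] r(4) by simp
    ultimately show ?thesis by auto
  qed
  ultimately show ?thesis
    using unique_color colorings_range[OF C(2,6)] colorings_range[OF C(3,6)] by blast
qed

text \<open>Consecutive cliques share at least \<open>l\<close> of their \<open>l + 1\<close>
  vertices, so the first one to meet \<open>B\<close> does so in its only new vertex.\<close>

lemma clique_step_cases:
  assumes "(P, Q) \<in> clique_steps l V E X" "P \<inter> set B = {}" "Q \<inter> set B \<noteq> {}"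
  obtains u where "u \<in> Q - P" "u \<in> set B" "Q = insert u (P \<inter> Q)" "Q \<inter> set B \<subseteq> {u}"
proof -
  obtain u where u: "u \<in> Q - P" "u \<in> set B" using assms by blast
  have "Q = insert u (P \<inter> Q)"
    using assms(1) u finite_clique by (intro insert_of_card[of Q _ l]) (auto simp: clique_steps_def)
  then have "Q \<inter> set B \<subseteq> {u}" using assms(2) by blast
  with u \<open>Q = _\<close> show ?thesis using that by blast
qed

text \<open>Among all cancelling pairs \<open>v, v\<close> take one with shortest \<open>B\<close>. If \<open>B\<close> moved a neighbour of
  \<open>v\<close>, then walking along a chain of cliques through \<open>v\<close>, the first one to meet \<open>B\<close> would meet it in
  a vertex that has to return to its colour, so it would yield a shorter cancelling pair.\<close>

lemma innermost_cancellation: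
  assumes "walk V E k \<phi> \<gamma> w p \<delta>" "w = A @ v # B @ v # C"
    and "is_clique V E Q" "card Q = l + 1" "v \<in> Q" "Q \<inter> set B = {}"
  shows "\<exists>A v B C. w = A @ v # B @ v # C \<and> (\<forall>u\<in>set B. u \<noteq> v \<and> {u, v} \<notin> E)"
  using assms(2-)
proof (induction "length B" arbitrary: A v B C Q rule: less_induct)
  case less
  show ?case
  proof (rule ccontr)
    assume neg: "\<not> ?case"
    have IH: False if "w = A' @ v' # B' @ v' # C'" "is_clique V E Q'" "card Q' = l + 1"
        "v' \<in> Q'" "Q' \<inter> set B' = {}" "length B' < length B" for A' v' B' C' Q'
      using less.hyps[OF that(6,1-5)] neg by blast
    from neg less.prems obtain u where u: "u \<in> set B" "{u, v} \<in> E" by blast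
    from assms(1) less.prems(1) obtain \<gamma>1 \<gamma>2 \<gamma>3 \<gamma>4 q where r:
        "recolor V E k v \<gamma>1 \<gamma>2" "walk V E k \<phi> \<gamma>2 B q \<gamma>3" "recolor V E k v \<gamma>3 \<gamma>4"
      by (metis walk_appendE walk_ConsE)
    have ret: "\<gamma>4 v = \<gamma>1 v" using return_color[OF r less.prems(2-5)] .
    have "is_clique V E {u, v}" using edgeD[OF u(2)] u(2) by (auto simp: is_clique_def insert_commute)
    moreover have "card {u, v} \<le> l + 1" using edgeD[OF u(2)] k by auto
    ultimately obtain R where R: "is_clique V E R" "card R = l + 1" "{u, v} \<subseteq> R"
      using extend by blast
    \<comment> \<open>The chain is pinned to \<open>v\<close>, so that the common part of
      consecutive cliques contains \<open>v\<close>, as \<open>same_color\<close> demands of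
      \<open>F\<close>.\<close>
    have "(Q, R) \<in> (clique_steps l V E {v})\<^sup>*"
      using chain less.prems(2-4) R by simp
    then have "R \<inter> set B = {}"
    proof (induction rule: rtrancl_induct)
      case base
      show ?case using less.prems(5) .
    next
      case (step P Q')
      have Q': "is_clique V E Q'" "card Q' = l + 1" "v \<in> P" "v \<in> Q'" "is_clique V E P"
          "l \<le> card (P \<inter> Q')"
        using step.hyps(2) by (auto simp: clique_steps_def)
      show ?case
      proof (rule ccontr)
        assume "Q' \<inter> set B \<noteq> {}"
        with step obtain x where x: "x \<in> Q' - P" "x \<in> set B" "Q' = insert x (P \<inter> Q')" "Q' \<inter> set B \<subseteq> {x}"
          by (auto elim: clique_step_cases)
        from x(4,2) show False
        proof (cases rule: single_or_repeated)
          case (single B1 B2)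
          have "\<gamma>2 x \<noteq> \<gamma>3 x" using walk_once r(2) single by metis
          moreover have "\<gamma>2 x = \<gamma>3 x"
          proof (rule same_color[OF r ret])
            show "is_clique V E (P \<inter> Q')" "is_clique V E (insert x (P \<inter> Q'))"
              using Q'(1,5) x(3) by (auto simp: is_clique_def)
          qed (use Q' x step.IH in auto)
          ultimately show False by blast
        next
          case (repeated B1 B2 B3)
          have "w = (A @ v # B1) @ x # B2 @ x # (B3 @ v # C)" using less.prems(1) repeated(1) by simp
          from IH[OF this Q'(1,2) _ repeated(2)] x(1) repeated(1) show False by simp
        qed
      qed
    qed
    then show False using R u by blast
  qed
qed

text \<open>For an innermost pair, \<open>B\<close> contains neither \<open>v\<close> nor a
  neighbour of \<open>v\<close>. Hence \<open>B\<close> can be walked directly from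
  \<open>\<gamma>1\<close>, and it ends in \<open>\<gamma>4\<close>, because \<open>v\<close>
  returns to its old colour. Both steps at \<open>v\<close> can thus be deleted; the final equation
  records what each piece contributes to the parity.\<close>

lemma cancel_walk:
  assumes w: "walk V E k \<phi> \<gamma> w p \<delta>" "w = A0 @ v0 # B0 @ v0 # C0"
    and Q0: "is_clique V E Q0" "card Q0 = l + 1" "v0 \<in> Q0" "Q0 \<inter> set B0 = {}"
    and \<phi>: "shift_invariant V E k \<phi>"
  obtains A v B C pA pB pC \<gamma>1 \<gamma>2 \<gamma>3 \<gamma>4 where "w = A @ v # B @ v # C"
    "walk V E k \<phi> \<gamma> A pA \<gamma>1" "recolor V E k v \<gamma>1 \<gamma>2" "walk V E k \<phi> \<gamma>2 B pB \<gamma>3"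
    "recolor V E k v \<gamma>3 \<gamma>4" "walk V E k \<phi> \<gamma>4 C pC \<delta>" "walk V E k \<phi> \<gamma>1 B pB \<gamma>4"
    "\<forall>u\<in>set B. u \<noteq> v \<and> {u, v} \<notin> E" "p = (pA \<noteq> (\<phi> \<gamma>1 \<gamma>2 \<noteq> (pB \<noteq> (\<phi> \<gamma>3 \<gamma>4 \<noteq> pC))))"
proof -
  from innermost_cancellation[OF w Q0] obtain A v B C where
    d: "w = A @ v # B @ v # C" "\<forall>u\<in>set B. u \<noteq> v \<and> {u, v} \<notin> E" by blast
  from w(1) d(1) obtain pA p1 \<gamma>1 where 1: "walk V E k \<phi> \<gamma> A pA \<gamma>1"
      "walk V E k \<phi> \<gamma>1 (v # B @ v # C) p1 \<delta>" "p = (pA \<noteq> p1)"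
    by (metis walk_appendE)
  from 1(2) obtain \<gamma>2 p2 where 2: "recolor V E k v \<gamma>1 \<gamma>2" "walk V E k \<phi> \<gamma>2 (B @ v # C) p2 \<delta>"
      "p1 = (\<phi> \<gamma>1 \<gamma>2 \<noteq> p2)"
    by (rule walk_ConsE)
  from 2(2) obtain \<gamma>3 pB p3 where 3: "walk V E k \<phi> \<gamma>2 B pB \<gamma>3"
      "walk V E k \<phi> \<gamma>3 (v # C) p3 \<delta>" "p2 = (pB \<noteq> p3)"
    by (rule walk_appendE)
  from 3(2) obtain \<gamma>4 pC where 4: "recolor V E k v \<gamma>3 \<gamma>4" "walk V E k \<phi> \<gamma>4 C pC \<delta>"
      "p3 = (\<phi> \<gamma>3 \<gamma>4 \<noteq> pC)"
    by (rule walk_ConsE)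
  have "v \<in> V" using 2(1) by (simp add: recolor_def)
  then have "is_clique V E {v}" by (simp add: is_clique_def)
  then obtain Q where Q: "is_clique V E Q" "card Q = l + 1" "v \<in> Q" using extend[of "{v}"] by auto
  have "Q \<inter> set B = {}" using Q d(2) by (auto simp: is_clique_def)
  then have ret: "\<gamma>4 v = \<gamma>1 v" using return_color[OF 2(1) 3(1) 4(1) Q] by blast
  have eq: "\<gamma>2(v := \<gamma>1 v) = \<gamma>1" "\<gamma>3(v := \<gamma>1 v) = \<gamma>4"
    using 2(1) 4(1) ret by (auto simp: recolor_def fun_eq_iff)
  have "walk V E k \<phi> (\<gamma>2(v := \<gamma>1 v)) B pB (\<gamma>3(v := \<gamma>1 v))"
    using walk_shift[OF 3(1) d(2) _ \<phi>, of "\<gamma>1 v"] eq(1) 2(1) by (simp add: recolor_def)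
  then have "walk V E k \<phi> \<gamma>1 B pB \<gamma>4" unfolding eq .
  moreover have "p = (pA \<noteq> (\<phi> \<gamma>1 \<gamma>2 \<noteq> (pB \<noteq> (\<phi> \<gamma>3 \<gamma>4 \<noteq> pC))))"
    using 1(3) 2(3) 3(3) 4(3) by blast
  ultimately show ?thesis using that d 1(1) 2(1) 3(1) 4(1,2) by blast
qed

lemma closed_walk_cancels:
  assumes K: "is_clique V E K" "card K = l + 2" and w: "walk V E k \<phi> \<gamma> w p \<gamma>" "w \<noteq> []"
  shows "\<exists>Q A v B C. is_clique V E Q \<and> card Q = l + 1 \<and> w = A @ v # B @ v # C \<and> v \<in> Q \<and> Q \<inter> set B = {}"
proof (rule ccontr)
  assume neg: "\<not> ?thesis"
  have Kw: "K \<inter> set w = {}" using walk_letter[OF w(1)] frozen[OF K] by blast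
  obtain P where P: "P \<subseteq> K" "card P = l + 1"
    using obtain_subset_with_card_n[of "l + 1" K] K(2) by auto
  obtain v where v: "v \<in> set w" using w(2) by (cases w) auto
  then have "v \<in> V" using walk_letter[OF w(1)] by (auto simp: recolor_def)
  then obtain R where R: "is_clique V E R" "card R = l + 1" "v \<in> R"
    using extend[of "{v}"] by (auto simp: is_clique_def)
  have "(P, R) \<in> (clique_steps l V E {})\<^sup>*"
    using chain[of P "{}" R] P R is_clique_subset[OF K(1) P(1)] by simp
  then have "R \<inter> set w = {}"
  proof (induction rule: rtrancl_induct)
    case base
    then show ?case using P Kw by blast
  next
    case (step P Q)
    have Q: "is_clique V E Q" "card Q = l + 1" using step.hyps(2) by (auto simp: clique_steps_def)
    show ?case
    proof (rule ccontr)
      assume "Q \<inter> set w \<noteq> {}"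
      with step obtain x where x: "x \<in> Q - P" "x \<in> set w" "Q \<inter> set w \<subseteq> {x}"
        by (auto elim: clique_step_cases)
      from x(3,2) show False
      proof (cases rule: single_or_repeated)
        case (single A B)
        then show False using walk_once w(1) by metis
      next
        case (repeated A B C)
        then show False using neg Q x(1) by blast
      qed
    qed
  qed
  then show False using R v by blast
qed

section \<open>Parity of the crossings of an edge\<close>

lemma csg_parity_invariant:
  assumes T: "is_clique V E T" and S: "S \<noteq> S'"
  shows "shift_invariant V E k (\<lambda>\<beta> \<beta>'. {component V E k T \<beta>, component V E k T \<beta>'} = {S, S'})"
proof -
  let ?c = "component V E k T"
  have *: "{?c (\<beta>(v := a)), ?c (\<beta>'(v := a))} = {S, S'} \<longleftrightarrow> {?c \<beta>, ?c \<beta>'} = {S, S'}"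
    if uv: "u \<noteq> v" "{u, v} \<notin> E" and r: "recolor V E k u \<beta> \<beta>'" "recolor V E k u (\<beta>(v := a)) (\<beta>'(v := a))"
    for u v a \<beta> \<beta>'
  proof (cases "u \<in> T")
    case False
    show ?thesis
      unfolding component_recolor[OF r(1) False] component_recolor[OF r(2) False]
      using S by (auto simp: doubleton_eq_iff)
  next
    case True
    \<comment> \<open>The clique \<open>T\<close> contains \<open>u\<close> and so not its
      non-neighbour \<open>v\<close>; changing the colour of \<open>v\<close> therefore stays within
      a component.\<close>
    then have v: "v \<notin> T" using uv T by (auto simp: is_clique_def)
    have "?c (\<eta>(v := a)) = ?c \<eta>" if "\<eta> \<in> colorings V E k" "\<eta>(v := a) \<in> colorings V E k" for \<eta>
    proof (cases "\<eta> v = a")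
      case True
      then show ?thesis by (simp add: fun_upd_idem)
    next
      case False
      have "v \<in> V"
        using False colorings_outside[OF that(1), of v] colorings_outside[OF that(2), of v] by auto
      then have "recolor V E k v \<eta> (\<eta>(v := a))" using that False by (simp add: recolor_def)
      then show ?thesis using component_recolor v by metis
    qed
    then show ?thesis using r by (simp add: recolor_def)
  qed
  show ?thesis unfolding shift_invariant_def by (intro allI impI) (rule *)
qed

text \<open>A cancellation removes two steps at \<open>v\<close>, of which both or neither cross the
  edge, so the parity is unchanged until the word is empty.\<close>

lemma closed_walk_even:
  assumes T: "is_clique V E T" and K: "is_clique V E K" "card K = l + 2" and S: "S \<noteq> S'"
    and "walk V E k (\<lambda>\<beta> \<beta>'. {component V E k T \<beta>, component V E k T \<beta>'} = {S, S'}) \<gamma> w p \<gamma>"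
      (is "walk V E k ?\<phi> \<gamma> w p \<gamma>")
  shows "\<not> p"
  using assms(5)
proof (induction "length w" arbitrary: w p rule: less_induct)
  case less
  let ?c = "component V E k T"
  show ?case
  proof (cases "w = []")
    case True
    then show ?thesis using less.prems walk_NilE by blast
  next
    case False
    from closed_walk_cancels[OF K less.prems False] obtain Q A0 v0 B0 C0 where
      q: "is_clique V E Q" "card Q = l + 1" "w = A0 @ v0 # B0 @ v0 # C0" "v0 \<in> Q" "Q \<inter> set B0 = {}"
      by blast
    from cancel_walk[OF less.prems q(3,1,2,4,5) csg_parity_invariant[OF T S]]
    obtain A v B C pA pB pC \<gamma>1 \<gamma>2 \<gamma>3 \<gamma>4 where d: "w = A @ v # B @ v # C"
      "walk V E k ?\<phi> \<gamma> A pA \<gamma>1" "recolor V E k v \<gamma>1 \<gamma>2" "walk V E k ?\<phi> \<gamma>2 B pB \<gamma>3"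
      "recolor V E k v \<gamma>3 \<gamma>4" "walk V E k ?\<phi> \<gamma>4 C pC \<gamma>" "walk V E k ?\<phi> \<gamma>1 B pB \<gamma>4"
      "\<forall>u\<in>set B. u \<noteq> v \<and> {u, v} \<notin> E" "p = (pA \<noteq> (?\<phi> \<gamma>1 \<gamma>2 \<noteq> (pB \<noteq> (?\<phi> \<gamma>3 \<gamma>4 \<noteq> pC))))" .
    have "length (A @ B @ C) < length w" using d(1) by simp
    from less.hyps[OF this walk_append[OF d(2) walk_append[OF d(7,6)]]]
    have even: "\<not> (pA \<noteq> (pB \<noteq> pC))" .
    \<comment> \<open>If \<open>v\<close> is in \<open>T\<close>, then \<open>B\<close> consists of
      non-neighbours of \<open>v\<close> and misses \<open>T\<close>, so the two steps link the same
      pair of components. If \<open>v\<close> is not in \<open>T\<close>, neither step leaves its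
      component.\<close>
    have "{?c \<gamma>1, ?c \<gamma>2} = {S, S'} \<longleftrightarrow> {?c \<gamma>3, ?c \<gamma>4} = {S, S'}"
    proof (cases "v \<in> T")
      case True
      then have "T \<inter> set B = {}" using T d(8) by (auto simp: is_clique_def)
      then have "?c \<gamma>2 = ?c \<gamma>3" "?c \<gamma>1 = ?c \<gamma>4" using walk_component d(4,7) by blast+
      then show ?thesis by (simp add: insert_commute)
    next
      case False
      show ?thesis
        unfolding component_recolor[OF d(3) False] component_recolor[OF d(5) False]
        using S by (auto simp: doubleton_eq_iff)
    qed
    moreover have "\<not> (a \<noteq> (x \<noteq> (b \<noteq> (y \<noteq> c))))" if "\<not> (a \<noteq> (b \<noteq> c))" "x = y" for a b c x y
      using that by auto
    ultimately show ?thesis unfolding d(9) using even by presburger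
  qed
qed

text \<open>A cycle crosses its edge \<open>{cs ! 0, cs ! 1}\<close> exactly once.\<close>

lemma forest_csg:
  assumes T: "is_clique V E T" and K: "is_clique V E K" "card K = l + 2"
  shows "forest (csg_nodes V E k T) (csg_edges V E k T)"
  unfolding forest_def
proof
  let ?c = "component V E k T"
  assume "\<exists>cs. length cs \<ge> 3 \<and> distinct cs \<and> set cs \<subseteq> csg_nodes V E k T \<and>
      (\<forall>i<length cs. {cs ! i, cs ! ((i + 1) mod length cs)} \<in> csg_edges V E k T)"
  then obtain cs where cs: "length cs \<ge> 3" "distinct cs" "set cs \<subseteq> csg_nodes V E k T"
    "\<And>i. i < length cs \<Longrightarrow> {cs ! i, cs ! ((i + 1) mod length cs)} \<in> csg_edges V E k T" by blast
  let ?n = "length cs"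
  define \<phi> where "\<phi> = (\<lambda>\<beta> \<beta>'. {?c \<beta>, ?c \<beta>'} = {cs ! 0, cs ! 1})"
  have "0 < ?n" "1 < ?n" using cs(1) by linarith+
  then have ne: "cs ! 0 \<noteq> cs ! 1" using nth_eq_iff_index_eq[OF cs(2), of 0 1] by simp
  have const: "\<forall>v \<beta> \<beta>'. v \<notin> T \<longrightarrow> recolor V E k v \<beta> \<beta>' \<longrightarrow> \<not> \<phi> \<beta> \<beta>'"
  proof (intro allI impI)
    fix v \<beta> \<beta>' assume "v \<notin> T" "recolor V E k v \<beta> \<beta>'"
    then have "?c \<beta> = ?c \<beta>'" by (intro component_recolor)
    then show "\<not> \<phi> \<beta> \<beta>'" using ne by (auto simp: \<phi>_def doubleton_eq_iff)
  qed
  have within: "\<exists>w. walk V E k \<phi> \<alpha> w False \<beta>" if "?c \<alpha> = ?c \<beta>" "\<alpha> \<in> colorings V E k" for \<alpha> \<beta>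
  proof -
    have "(\<alpha>, \<beta>) \<in> (label_rel V E k T)\<^sup>*"
      using that(1) component_self[of \<beta> V E k T] by (auto simp: component_def)
    from component_walk[OF this that(2) const] show ?thesis by blast
  qed
  have seg: "\<exists>w \<beta>. walk V E k \<phi> \<alpha> w ({cs ! i, cs ! ((i + 1) mod ?n)} = {cs ! 0, cs ! 1}) \<beta> \<and>
      ?c \<beta> = cs ! ((i + 1) mod ?n)"
    if i: "i < ?n" and \<alpha>: "?c \<alpha> = cs ! i" "\<alpha> \<in> colorings V E k" for i \<alpha>
  proof -
    obtain v \<gamma> \<delta> where r: "recolor V E k v \<gamma> \<delta>" "cs ! i = ?c \<gamma>" "cs ! ((i + 1) mod ?n) = ?c \<delta>"
      using cs(4)[OF i] unfolding csg_edge_iff by blast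
    obtain w where "walk V E k \<phi> \<alpha> w False \<gamma>" using within[of \<alpha> \<gamma>] \<alpha> r(2) by auto
    from walk_append[OF this walk_single[OF r(1)]] r show ?thesis by (auto simp: \<phi>_def)
  qed
  have n0: "0 < ?n" "1 mod ?n = 1" using cs(1) by auto
  have "cs ! 0 \<in> csg_nodes V E k T" using cs(1,3) n0 by (meson nth_mem subsetD)
  then obtain \<gamma> where \<gamma>: "\<gamma> \<in> colorings V E k" "?c \<gamma> = cs ! 0" by (auto simp: csg_nodes_eq)
  \<comment> \<open>The walk follows the edges \<open>0, ..., i\<close> of the cycle, of which only
    the first is counted, so its parity is odd for every \<open>i\<close>.\<close>
  have path: "\<exists>w \<beta>. walk V E k \<phi> \<gamma> w True \<beta> \<and> ?c \<beta> = cs ! (Suc i mod ?n)" if "i < ?n" for i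
    using that
  proof (induction i)
    case 0
    then show ?case using seg[OF n0(1) \<gamma>(2,1)] n0 by simp
  next
    case (Suc i)
    then obtain w \<beta> where w: "walk V E k \<phi> \<gamma> w True \<beta>" "?c \<beta> = cs ! Suc i" by auto
    \<comment> \<open>A later edge could equal the first one only when traversed backwards; this
      would force \<open>i = 0\<close> and \<open>2 mod ?n = 0\<close>, against
      \<open>3 \<le> ?n\<close>.\<close>
    have "{cs ! Suc i, cs ! ((Suc i + 1) mod ?n)} \<noteq> {cs ! 0, cs ! 1}"
    proof
      assume eq: "{cs ! Suc i, cs ! ((Suc i + 1) mod ?n)} = {cs ! 0, cs ! 1}"
      have idx: "a = b" if "cs ! a = cs ! b" "a < ?n" "b < ?n" for a b
        using nth_eq_iff_index_eq[OF cs(2) that(2,3)] that(1) by blast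
      have "cs ! Suc i \<noteq> cs ! 0" using idx[of "Suc i" 0] Suc.prems n0(1) by blast
      with eq have "cs ! Suc i = cs ! 1" "cs ! ((Suc i + 1) mod ?n) = cs ! 0"
        by (metis doubleton_eq_iff)+
      then have "Suc i = 1" "(Suc i + 1) mod ?n = 0"
        using idx[of "Suc i" 1] idx[of "(Suc i + 1) mod ?n" 0] Suc.prems cs(1) n0(1) by simp_all
      then show False using cs(1) by auto
    qed
    then have "\<exists>w' \<beta>'. walk V E k \<phi> \<beta> w' False \<beta>' \<and> ?c \<beta>' = cs ! ((Suc i + 1) mod ?n)"
      using seg[OF Suc.prems w(2) walk_colorings(2)[OF w(1)]] by simp
    then obtain w' \<beta>' where w': "walk V E k \<phi> \<beta> w' False \<beta>'" "?c \<beta>' = cs ! ((Suc i + 1) mod ?n)"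
      by blast
    from walk_append[OF w(1) w'(1)] have "walk V E k \<phi> \<gamma> (w @ w') True \<beta>'" by simp
    then show ?case using w'(2) by auto
  qed
  obtain w \<beta> where w: "walk V E k \<phi> \<gamma> w True \<beta>" "?c \<beta> = cs ! 0"
  proof -
    have "?n - 1 < ?n" "Suc (?n - 1) mod ?n = 0" using n0(1) by simp_all
    with path[OF this(1)] show ?thesis using that by auto
  qed
  obtain w' where "walk V E k \<phi> \<beta> w' False \<gamma>"
    using within[of \<beta> \<gamma>] w \<gamma> walk_colorings(2)[OF w(1)] by auto
  from walk_append[OF w(1) this] have "walk V E k \<phi> \<gamma> (w @ w') True \<gamma>" by simp
  then show False using closed_walk_even[OF T K ne] unfolding \<phi>_def by blast
qed

text \<open>Pairs are cancelled until the two \<open>t\<close> themselves disappear, which leaves a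
  walk that avoids \<open>T\<close>. A pair always exists: an \<open>(l + 1)\<close>-clique
  containing \<open>T\<close> has at most one further vertex \<open>u\<close>. If \<open>u\<close>
  moves between the two \<open>t\<close>, it moves more than once, by \<open>same_color\<close> with
  \<open>T\<close> as \<open>F\<close>; otherwise the two \<open>t\<close> form a pair.\<close>

lemma detour_component:
  assumes T: "is_clique V E T" "l \<le> card T" "card T \<le> l + 1"
    and "walk V E k (\<lambda>_ _. False) \<gamma> w p \<delta>" "filter (\<lambda>u. u \<in> T) w = [t, t]" "\<gamma> t = \<delta> t"
  shows "component V E k T \<gamma> = component V E k T \<delta>"
  using assms(4,5)
proof (induction "length w" arbitrary: w p rule: less_induct)
  case less
  let ?f = "filter (\<lambda>u. u \<in> T)" and ?c = "component V E k T"
  obtain W0 U where U: "w = W0 @ t # U" "\<forall>u\<in>set W0. u \<notin> T" "t \<in> T" "[t] = ?f U"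
    using iffD1[OF filter_eq_Cons_iff less.prems(2)] by blast
  obtain W1 W2 where W: "U = W1 @ t # W2" "\<forall>u\<in>set W1. u \<notin> T" "[] = ?f W2"
    using iffD1[OF filter_eq_Cons_iff U(4)[symmetric]] by blast
  have disj: "t \<notin> set W0" "t \<notin> set W2" "T \<inter> set W1 = {}"
    using U(2,3) W(2) W(3)[symmetric] by (auto simp: filter_empty_conv)
  obtain Q where Q: "is_clique V E Q" "card Q = l + 1" "T \<subseteq> Q" using extend T by blast
  have "\<exists>A v B C. w = A @ v # B @ v # C \<and> v \<in> Q \<and> Q \<inter> set B = {}"
  proof (cases "Q \<inter> set W1 = {}")
    case True
    then show ?thesis using U W Q(3) by blast
  next
    case False
    then obtain u where u: "u \<in> Q - T" "u \<in> set W1" using disj by blast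
    have QT: "Q = insert u T" using insert_of_card[OF finite_clique[OF Q(1)] Q(3,2) T(2) u(1)] .
    then have "Q \<inter> set W1 \<subseteq> {u}" using disj by auto
    from this u(2) show ?thesis
    proof (cases rule: single_or_repeated)
      case (single A B)
      from less.prems(1) obtain \<gamma>1 \<gamma>2 \<gamma>3 \<gamma>4 p0 p1 p2 where r:
          "walk V E k (\<lambda>_ _. False) \<gamma> W0 p0 \<gamma>1" "recolor V E k t \<gamma>1 \<gamma>2"
          "walk V E k (\<lambda>_ _. False) \<gamma>2 W1 p1 \<gamma>3" "recolor V E k t \<gamma>3 \<gamma>4"
          "walk V E k (\<lambda>_ _. False) \<gamma>4 W2 p2 \<delta>"
        unfolding U(1) W(1) by (metis walk_appendE walk_ConsE)
      have "\<gamma>4 t = \<gamma>1 t" using walk_other[OF r(1) disj(1)] walk_other[OF r(5) disj(2)] assms(6) by simp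
      then have "\<gamma>2 u = \<gamma>3 u"
        using same_color[OF r(2-4) _ T(1,2) U(3) disj(3)] u(1) Q(1) QT by auto
      moreover have "\<gamma>2 u \<noteq> \<gamma>3 u" using walk_once r(3) single by metis
      ultimately show ?thesis by blast
    next
      case (repeated B1 B2 B3)
      then have "w = (W0 @ t # B1) @ u # B2 @ u # (B3 @ t # W2)" using U W by simp
      then show ?thesis using repeated(2) u(1) by blast
    qed
  qed
  then obtain A0 v0 B0 C0 where q: "w = A0 @ v0 # B0 @ v0 # C0" "v0 \<in> Q" "Q \<inter> set B0 = {}" by blast
  have inv: "shift_invariant V E k (\<lambda>_ _. False)" by (simp add: shift_invariant_def)
  from cancel_walk[OF less.prems(1) q(1) Q(1,2) q(2,3) inv]
  obtain A v B C pA pB pC \<gamma>1 \<gamma>4 where d: "w = A @ v # B @ v # C"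
    "walk V E k (\<lambda>_ _. False) \<gamma> A pA \<gamma>1" "walk V E k (\<lambda>_ _. False) \<gamma>4 C pC \<delta>"
    "walk V E k (\<lambda>_ _. False) \<gamma>1 B pB \<gamma>4" by metis
  show ?case
  proof (cases "v \<in> T")
    case True
    \<comment> \<open>The word has exactly two letters in \<open>T\<close>, so the cancelled pair is
      \<open>t, t\<close> and nothing else in the word lies in \<open>T\<close>.\<close>
    then have "?f A = []" "?f B = []" "?f C = []"
      using less.prems(2) unfolding d(1) by (auto simp: append_eq_Cons_conv)
    then have "T \<inter> set A = {}" "T \<inter> set B = {}" "T \<inter> set C = {}" by (auto simp: filter_empty_conv)
    then show ?thesis using walk_component d(2-4) by metis
  next
    case False
    then have "?f (A @ B @ C) = [t, t]" using less.prems(2) d(1) by simp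
    moreover have "walk V E k (\<lambda>_ _. False) \<gamma> (A @ B @ C) (pA \<noteq> (pB \<noteq> pC)) \<delta>"
      using walk_append[OF d(2) walk_append[OF d(4,3)]] .
    moreover have "length (A @ B @ C) < length w" using d(1) by simp
    ultimately show ?thesis using less.hyps by blast
  qed
qed

text \<open>Two neighbours of \<open>x\<close> with the same label are joined by a walk that moves a
  vertex \<open>v\<close> of \<open>T\<close> into \<open>x\<close>, stays in \<open>x\<close>, and
  moves \<open>v\<close> out to the same colour again. By \<open>detour_component\<close> both ends
  lie in one component.\<close>

lemma INP_csg:
  assumes T: "is_clique V E T" "l \<le> card T" "card T \<le> l + 2"
  shows "INP (csg_nodes V E k T) (csg_edges V E k T) (csg_label T)"
  unfolding INP_def
proof (intro ballI impI notI)
  let ?c = "component V E k T"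
  fix x y z
  assume e: "{x, y} \<in> csg_edges V E k T \<and> {x, z} \<in> csg_edges V E k T \<and> y \<noteq> z"
    and lab: "csg_label T y = csg_label T z"
  obtain v \<gamma> \<delta> where r: "x \<noteq> y" "recolor V E k v \<gamma> \<delta>" "x = ?c \<gamma>" "y = ?c \<delta>"
    using e unfolding csg_edge_iff by blast
  obtain v' \<gamma>' \<delta>' where r': "x \<noteq> z" "recolor V E k v' \<gamma>' \<delta>'" "x = ?c \<gamma>'" "z = ?c \<delta>'"
    using e unfolding csg_edge_iff by blast
  have v: "v \<in> T" "v' \<in> T" using r r' component_recolor by metis+
  have "restrict \<delta> T = restrict \<delta>' T" using lab r r' by (simp add: csg_label_component)
  then have \<delta>: "\<delta> u = \<delta>' u" if "u \<in> T" for u using that by (metis restrict_apply')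
  have path: "(\<gamma>, \<gamma>') \<in> (label_rel V E k T)\<^sup>*"
    using r(3) r'(3) component_self[of \<gamma>' V E k T] by (auto simp: component_def)
  then have "restrict \<gamma> T = restrict \<gamma>' T" by (rule label_rel_rtrancl)
  then have \<gamma>: "\<gamma> u = \<gamma>' u" if "u \<in> T" for u using that by (metis restrict_apply')
  \<comment> \<open>On \<open>T\<close>, \<open>\<gamma>\<close> agrees with
    \<open>\<gamma>'\<close> and \<open>\<delta>\<close> with \<open>\<delta>'\<close>, so both
    steps recolour the one vertex of \<open>T\<close> where these labels differ.\<close>
  have vv: "v' = v" using \<delta> \<gamma> v r(2) r'(2) unfolding recolor_def by metis
  \<comment> \<open>A vertex of \<open>T\<close> moves, so \<open>T\<close> is not a frozen
    clique.\<close>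
  have "card T \<noteq> l + 2" using frozen[OF T(1) _ r(2)] v by blast
  then have T': "card T \<le> l + 1" using T(3) by simp
  have "\<gamma> \<in> colorings V E k" using r(2) by (simp add: recolor_def)
  then obtain w where w: "walk V E k (\<lambda>_ _. False) \<gamma> w False \<gamma>'" "T \<inter> set w = {}"
    using component_walk[OF path, of "\<lambda>_ _. False"] by auto
  have "walk V E k (\<lambda>_ _. False) \<delta> ([v] @ w @ [v]) False \<delta>'"
    using walk_append[OF walk_single[OF recolor_sym[OF r(2)]] walk_append[OF w(1) walk_single[OF r'(2)[unfolded vv]]]]
    by fastforce
  moreover have "filter (\<lambda>u. u \<in> T) ([v] @ w @ [v]) = [v, v]" using v w(2) by (auto simp: filter_empty_conv)
  ultimately have "?c \<delta> = ?c \<delta>'" using detour_component[OF T(1,2) T'] \<delta>[OF v(1)] by blast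
  then show False using e r r' by simp
qed

end

section \<open>The two cases combined\<close>

theorem theorem1:
  fixes V :: "'a set" and E :: "'a set set" and T :: "'a set" and k :: nat
  assumes "k \<ge> 3"
    and "simple_graph V E"
    and "l_connected (k - 2) V E"
    and "colorable V E k"
    and "chordal V E"
    and "is_clique V E T"
    and "card T \<ge> k - 2"
  shows "color_complete (card T) k (csg_nodes V E k T) (csg_edges V E k T) (csg_label T)
    \<or> (forest (csg_nodes V E k T) (csg_edges V E k T) \<and>
       INP (csg_nodes V E k T) (csg_edges V E k T) (csg_label T))"
proof -
  define l where "l = k - 2"
  have l: "k = l + 2" "1 \<le> l" using assms(1) by (auto simp: l_def)
  have finV: "finite V" and loopless: "\<And>v. {v} \<notin> E"
    using assms(2) by (auto simp: simple_graph_def)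
  have conn: "l_connected l V E" using assms(3) by (simp add: l_def)
  obtain \<gamma> where \<gamma>: "\<gamma> \<in> colorings V E k" using assms(4) by (auto simp: colorable_def)
  have small: "card K \<le> l + 2" if K: "is_clique V E K" for K
  proof -
    have "\<gamma> ` K \<subseteq> {1..k}"
      using colorings_range[OF \<gamma>] K unfolding is_clique_def by blast
    then show ?thesis
      using card_mono[of "{1..k}" "\<gamma> ` K"] card_image[OF clique_inj_on[OF K \<gamma>]] l(1) by simp
  qed
  \<comment> \<open>A construction from any starting clique supplies the extensions and chains; the
    empty set imposes no condition on it.\<close>
  have "is_clique V E {}" by (simp add: is_clique_def)
  from attach_exists[OF finV assms(5) conn this _ loopless]
  obtain Q0 where Q0: "is_clique V E Q0" "card Q0 = l + 1" "attach l E Q0 V" by auto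
  interpret clique_connected V E k l
  proof
    show "\<exists>Q. is_clique V E Q \<and> card Q = l + 1 \<and> X \<subseteq> Q" if "is_clique V E X" "card X \<le> l + 1" for X
      using clique_extend[OF Q0(3,1,2) finV that loopless] .
    show "(P, Q) \<in> (clique_steps l V E X)\<^sup>*"
      if "is_clique V E P" "card P = l + 1" "X \<subseteq> P" "is_clique V E Q" "card Q = l + 1" "X \<subseteq> Q" for P Q X
      using clique_chain[OF Q0(3,1,2) finV that small loopless] .
  qed (use assms(2) l in auto)
  show ?thesis
  proof (cases "\<exists>K. is_clique V E K \<and> card K = l + 2")
    case True
    then obtain K where K: "is_clique V E K" "card K = l + 2" by blast
    have "l \<le> card T" using assms(7) by (simp add: l_def)
    then show ?thesis using forest_csg[OF assms(6) K] INP_csg[OF assms(6) _ small[OF assms(6)]] by blast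
  next
    case False
    have small': "\<forall>K. is_clique V E K \<longrightarrow> card K \<le> l + 1"
    proof (intro allI impI)
      fix K assume K: "is_clique V E K"
      then have "card K \<noteq> l + 2" using False by blast
      then show "card K \<le> l + 1" using small[OF K] by simp
    qed
    then have cT: "l \<le> card T" "card T \<le> l + 1" using assms(6,7) by (auto simp: l_def)
    obtain Q where Q: "is_clique V E Q" "card Q = l + 1" "T \<subseteq> Q" "attach l E Q V"
      using attach_exists[OF finV assms(5) conn assms(6) cT(2) loopless] by blast
    \<comment> \<open>\<open>T\<close> misses at most one vertex \<open>q\<close> of
      \<open>Q\<close>, and \<open>q\<close> is adjacent to all of \<open>T\<close>, which has at
      least \<open>l\<close> vertices. So the construction of \<open>V\<close> can start at
      \<open>T\<close> itself.\<close>
    have "attach l E T Q"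
    proof (cases "T = Q")
      case True
      then show ?thesis using attach.base by metis
    next
      case False
      then obtain q where q: "q \<in> Q - T" using Q(3) by blast
      have "Q = insert q T" using insert_of_card[OF finite_clique[OF Q(1)] Q(3,2) cT(1) q] .
      then have N: "nbrs E T q = T" using Q(1) q by (auto simp: nbrs_def is_clique_def)
      have "is_clique T E T" using assms(6) by (auto simp: is_clique_def)
      then have "attach l E T (insert q T)"
        using attach.step[OF attach.base, of q T E l] q cT(1) N by simp
      then show ?thesis using \<open>Q = insert q T\<close> by simp
    qed
    then have "attach l E T V" by (rule attach_trans[OF Q(4)])
    then have "color_complete (card T) k (csg_nodes V E k T) (csg_edges V E k T) (csg_label T)"
      using color_complete_csg[OF assms(2) _ assms(6) _ small'] cT(1) l by simp
    then show ?thesis ..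
  qed
qed

end
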